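(* Let $m,\ell\ge1$ and $N=m\ell+2$. For every $(m+2)$-angulation $T$ of the polygon $P_N$, $\mathsf{brow}(\sigma(T))=\widetilde{\mathsf{rot}}(\mathsf{brow}(T))$; that is, $\mathsf{brow}\circ\sigma=\widetilde{\mathsf{rot}}\circ\mathsf{brow}$ as maps from $(m+2)$-angulations of $P_N$ to $m$-Dyck paths of order $\ell$.
   Context: $P_N$ has vertices $v_0,\ldots,v_{N-1}$ in clockwise order; $\sigma$ is the counterclockwise rotation $v_i\mapsto v_{i-1}$, so $\sigma(T)$ contains $(v_{i-1},v_{j-1})$ iff $T$ contains $(v_i,v_j)$. An $(m+2)$-angulation is a set of non-crossing diagonals cutting $P_N$ into $(m+2)$-gons (subgons). An $m$-Dyck path of order $\ell$ is a word in $U$ (step $(0,1)$) and $R$ (step $(1,0)$) giving a lattice path from $(0,0)$ to $(m\ell,\ell)$ staying weakly above $y=x/m$. The browse map: $\mathsf{brow}(T)$ is the word obtained by visiting $v_0,v_1,\ldots,v_{N-1}$ in this (clockwise) order and, at each visit of $v_i$, surveying the subgons incident to $v_i$ in counterclockwise order around $v_i$; for each subgon $Q$ encountered, append $U$ if this is the first time $Q$ is encountered, append $R$ if it is neither the first nor the $(m+2)$-th time, and append nothing if it is the $(m+2)$-th time. (This is an $m$-Dyck path of order $\ell$.) The map $\widetilde{\mathsf{rot}}$ on an $m$-Dyck path $D=w_1\cdots w_r$: let $k+1$ be the position of the first $R$ (so $D$ begins $U^kR$); let $H_D(j)=\sum_{t\le j}h(w_t)$ with $h(U)=m$, $h(R)=-1$;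 for each $1\le i\le k-1$ let $p'_i>k$ be the smallest integer with $H_D(p'_i)<mi$, and simultaneously insert a letter $U$ immediately after the $p'_i$-th letter for each such $i$; then delete the initial $U^kR$; finally prepend a $U$ and append an $R$. The result is $\widetilde{\mathsf{rot}}(D)$. *)

theory Defs
  imports Main
begin

text \<open>Vertices of P_N are the naturals 0..N-1 (v_i is i), in clockwise order.
  A diagonal is an unordered pair, represented as a two-element set of vertices.\<close>

definition is_side :: "nat \<Rightarrow> nat \<Rightarrow> nat \<Rightarrow> bool" where
  "is_side N a b \<longleftrightarrow> a < N \<and> b < N \<and>
     (b = a + 1 \<or> a = b + 1 \<or> (a = 0 \<and> b = N - 1) \<or> (b = 0 \<and> a = N - 1))"

definition is_diagonal :: "nat \<Rightarrow> nat set \<Rightarrow> bool" where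
  "is_diagonal N d \<longleftrightarrow> (\<exists>a b. d = {a, b} \<and> a < b \<and> b < N \<and> \<not> is_side N a b)"

definition crossing :: "nat set \<Rightarrow> nat set \<Rightarrow> bool" where
  "crossing d e \<longleftrightarrow> (\<exists>a b c f. ((d = {a, b} \<and> e = {c, f}) \<or> (d = {c, f} \<and> e = {a, b}))
                         \<and> a < c \<and> c < b \<and> b < f)"

definition is_edge :: "nat \<Rightarrow> nat set set \<Rightarrow> nat \<Rightarrow> nat \<Rightarrow> bool" where
  "is_edge N T a b \<longleftrightarrow> is_side N a b \<or> {a, b} \<in> T"

definition cyc_pairs :: "nat set \<Rightarrow> nat set set" where
  "cyc_pairs S = (let xs = sorted_list_of_set S in
     {{xs ! k, xs ! ((k + 1) mod length xs)} | k. k < length xs})"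

text \<open>A subgon (region) of the dissection T of P_N, given by its vertex set S:
  the boundary cycle of S (in clockwise order) consists of sides of P_N and diagonals
  of T, and no diagonal of T joins two non-consecutive vertices of S
  (i.e. no diagonal of T cuts through the interior of the polygon spanned by S).\<close>
definition is_subgon :: "nat \<Rightarrow> nat set set \<Rightarrow> nat set \<Rightarrow> bool" where
  "is_subgon N T S \<longleftrightarrow> S \<subseteq> {..<N} \<and> 3 \<le> card S \<and>
     (\<forall>p \<in> cyc_pairs S. \<exists>a b. p = {a, b} \<and> is_edge N T a b) \<and>
     (\<forall>d \<in> T. d \<subseteq> S \<longrightarrow> d \<in> cyc_pairs S)"

definition subgons :: "nat \<Rightarrow> nat set set \<Rightarrow> nat set set" where
  "subgons N T = {S. is_subgon N T S}"

definition is_angulation :: "nat \<Rightarrow> nat \<Rightarrow> nat set set \<Rightarrow> bool" where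
  "is_angulation N m T \<longleftrightarrow> (\<forall>d \<in> T. is_diagonal N d) \<and>
     (\<forall>d \<in> T. \<forall>e \<in> T. \<not> crossing d e) \<and>
     (\<forall>S \<in> subgons N T. card S = m + 2)"

definition sigma :: "nat \<Rightarrow> nat set set \<Rightarrow> nat set set" where
  "sigma N T = (\<lambda>d. (\<lambda>i. (i + N - 1) mod N) ` d) ` T"

datatype letter = U | R

text \<open>Position of vertex j seen from vertex i, clockwise: offset (j - i) mod N.
  Around v_i the subgons incident to v_i are ordered counterclockwise by decreasing
  values of this key (the direction towards v_(i-1) comes first, towards v_(i+1) last).\<close>
definition ccw_key :: "nat \<Rightarrow> nat \<Rightarrow> nat set \<Rightarrow> nat" where
  "ccw_key N i Q = Max ((\<lambda>j. (j + N - i) mod N) ` (Q - {i}))"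

definition subgons_at :: "nat \<Rightarrow> nat set set \<Rightarrow> nat \<Rightarrow> nat set list" where
  "subgons_at N T i =
     map (\<lambda>k. THE Q. Q \<in> subgons N T \<and> i \<in> Q \<and> ccw_key N i Q = k)
       (rev (sorted_list_of_set (ccw_key N i ` {Q \<in> subgons N T. i \<in> Q})))"

definition visits :: "nat \<Rightarrow> nat set set \<Rightarrow> nat set list" where
  "visits N T = concat (map (subgons_at N T) [0..<N])"

definition brow :: "nat \<Rightarrow> nat \<Rightarrow> nat set set \<Rightarrow> letter list" where
  "brow N m T = (let vs = visits N T in
     concat (map (\<lambda>p. let c = count_list (take p vs) (vs ! p) in
                       if c = 0 then [U] else if c < m + 1 then [R] else [])
             [0..<length vs]))"

definition hgt :: "nat \<Rightarrow> letter \<Rightarrow> int" where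
  "hgt m x = (if x = U then int m else -1)"

definition H :: "nat \<Rightarrow> letter list \<Rightarrow> nat \<Rightarrow> int" where
  "H m D j = sum_list (map (hgt m) (take j D))"

definition rot_tilde :: "nat \<Rightarrow> letter list \<Rightarrow> letter list" where
  "rot_tilde m D = (let k = length (takeWhile (\<lambda>x. x = U) D);
      p' = (\<lambda>i::nat. LEAST p. k < p \<and> H m D p < int m * int i);
      ins = concat (map (\<lambda>j. [D ! (j - 1)] @ replicate (card {i \<in> {1..k-1}. p' i = j}) U)
                      [1..<length D + 1])
    in [U] @ drop (k + 1) ins @ [R])"

end

theory Submission
  imports Defs
begin

text \<open>Each subgon is visited once per vertex, so the word produced at vertex \<open>i\<close> is
  \<open>R\<^sup>r U\<^sup>u\<close>, where \<open>r\<close> counts the subgons having \<open>i\<close> as a vertex strictly between their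
  minimum and their maximum, and \<open>u\<close> counts those with minimum \<open>i\<close>. Rotation only changes the
  roles of the vertices in the subgons at 0. These form a fan over the neighbours
  \<open>1 = a\<^sub>0 < \<dots> < a\<^sub>k = N - 1\<close> of 0; after rotation the subgon with vertices
  \<open>0, a\<^sub>j, \<dots>, a\<^sub>j\<^sub>+\<^sub>1\<close> is opened at \<open>a\<^sub>j\<close> and closed at 0. Hence the word changes by deleting
  \<open>U\<^sup>k R\<close>, inserting a \<open>U\<close> at each of \<open>a\<^sub>0, \<dots>, a\<^sub>k\<^sub>-\<^sub>1\<close> and appending an \<open>R\<close>. Adding up the
  contributions of the single subgons to the height shows that the end of the \<open>R\<close>-steps at
  \<open>a\<^sub>j\<close> is the first place where the height drops below \<open>m (k - j)\<close>.\<close>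

subsection \<open>Rotating subgons\<close>

text \<open>The cyclic order of the vertices, which unlike the linear one is invariant under rotation.\<close>

definition btw :: "nat \<Rightarrow> nat \<Rightarrow> nat \<Rightarrow> bool" where
  "btw x z y \<longleftrightarrow> (x < z \<and> z < y) \<or> (z < y \<and> y < x) \<or> (y < x \<and> x < z)"

text \<open>One of the two open arcs between \<open>x\<close> and \<open>y\<close> is free of
  \<open>S\<close>. This form of being consecutive on the boundary survives rotation, unlike the
  sorted list in \<open>cyc_pairs\<close>.\<close>

definition adj :: "nat set \<Rightarrow> nat \<Rightarrow> nat \<Rightarrow> bool" where
  "adj S x y \<longleftrightarrow> x \<in> S \<and> y \<in> S \<and> x \<noteq> y \<and> ((\<forall>z\<in>S. \<not> btw x z y) \<or> (\<forall>z\<in>S. \<not> btw y z x))"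

lemma adj_commute: "adj S x y \<longleftrightarrow> adj S y x"
  by (auto simp: adj_def)

text \<open>For \<open>x < y\<close> one arc is the interval between them and the other wraps around
  past 0; if the latter is empty, \<open>x\<close> and \<open>y\<close> are the extreme
  vertices.\<close>

lemma adj_less:
  assumes "x < y"
  shows "adj S x y \<longleftrightarrow>
    x \<in> S \<and> y \<in> S \<and> ((\<forall>z\<in>S. z \<le> x \<or> y \<le> z) \<or> (\<forall>z\<in>S. x \<le> z \<and> z \<le> y))"
proof -
  have "\<not> btw x z y \<longleftrightarrow> z \<le> x \<or> y \<le> z" "\<not> btw y z x \<longleftrightarrow> x \<le> z \<and> z \<le> y" for z
    using assms by (auto simp: btw_def)
  then show ?thesis using assms by (simp add: adj_def)
qed

text \<open>Positions in the sorted list increase strictly with the vertices, so \<open>btw\<close>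
  can be tested on positions, where an empty arc leads to the cyclic successor.\<close>

lemma cyc_pairs_eq_adj:
  assumes "finite S" "2 \<le> card S"
  shows "cyc_pairs S = {{x, y} | x y. adj S x y}"
proof -
  define xs where "xs = sorted_list_of_set S"
  define n where "n = length xs"
  have n: "n = card S" "2 \<le> n" and set: "set xs = S"
    using assms by (auto simp: xs_def n_def)
  have lt: "xs ! i < xs ! j \<longleftrightarrow> i < j" if "i < n" "j < n" for i j
    using sorted_wrt_nth_less[of "(<)" xs] strict_sorted_list_of_set[of S] that
    by (metis linorder_neqE_nat n_def order_less_asym xs_def)
  then have btw: "btw (xs ! i) (xs ! j) (xs ! k) \<longleftrightarrow> btw i j k" if "i < n" "j < n" "k < n" for i j k
    using that by (simp add: btw_def)
  have S: "z \<in> S \<longleftrightarrow> (\<exists>t<n. z = xs ! t)" for z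
    using set n_def by (metis in_set_conv_nth)
  have eq: "xs ! i = xs ! j \<longleftrightarrow> i = j" if "i < n" "j < n" for i j
    using lt[OF that] lt[OF that(2,1)] by (metis less_irrefl linorder_neqE_nat)
  have adj: "adj S (xs ! i) (xs ! j) \<longleftrightarrow> i \<noteq> j \<and> ((\<forall>t<n. \<not> btw i t j) \<or> (\<forall>t<n. \<not> btw j t i))"
    if "i < n" "j < n" for i j
  proof -
    have "(\<forall>z\<in>S. P z) \<longleftrightarrow> (\<forall>t<n. P (xs ! t))" for P
      using S by metis
    moreover have "xs ! i \<in> S" "xs ! j \<in> S" using S that by blast+
    ultimately show ?thesis using that unfolding adj_def by (simp add: btw eq)
  qed
  have step: "i \<noteq> j \<and> (\<forall>t<n. \<not> btw i t j) \<longleftrightarrow> j = (i + 1) mod n" if "i < n" "j < n" for i j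
  proof (cases "i + 1 < n")
    case True
    have "\<not> btw i t (i + 1)" for t by (auto simp: btw_def)
    moreover have "btw i (i + 1) j" if "j \<noteq> i" "j \<noteq> i + 1"
      using that by (auto simp: btw_def)
    ultimately show ?thesis using True by auto
  next
    case False
    then have i: "i = n - 1" using that by simp
    have none: "\<not> btw i t 0" if "t < n" for t using that by (auto simp: btw_def i)
    have some: "btw i 0 j" if "j \<noteq> i" "j \<noteq> 0"
      using that \<open>j < n\<close> i by (auto simp: btw_def)
    have "(i + 1) mod n = 0" "i \<noteq> 0" "0 < n" using i n by auto
    then show ?thesis using none some by metis
  qed
  show ?thesis
  proof (intro set_eqI iffI)
    fix p assume "p \<in> cyc_pairs S"
    then obtain k where k: "k < n" "p = {xs ! k, xs ! ((k + 1) mod n)}"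
      unfolding cyc_pairs_def Let_def xs_def[symmetric] n_def[symmetric] by blast
    then have "adj S (xs ! k) (xs ! ((k + 1) mod n))"
      using adj step n by (metis mod_less_divisor not_less_zero not_gr_zero)
    with k show "p \<in> {{x, y} | x y. adj S x y}" by blast
  next
    fix p assume "p \<in> {{x, y} | x y. adj S x y}"
    then obtain x y where p: "p = {x, y}" "adj S x y" by blast
    then obtain i j where ij: "i < n" "x = xs ! i" "j < n" "y = xs ! j"
      unfolding adj_def S by blast
    then have "j = (i + 1) mod n \<or> i = (j + 1) mod n"
      using p adj step by metis
    then show "p \<in> cyc_pairs S"
      using p ij insert_commute[of "xs ! i" "xs ! j" "{}"]
      unfolding cyc_pairs_def Let_def xs_def[symmetric] n_def[symmetric] by blast
  qed
qed

lemma is_edge_commute: "is_edge N T a b \<longleftrightarrow> is_edge N T b a"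
  by (auto simp: is_edge_def is_side_def insert_commute)

lemma is_subgon_iff:
  "is_subgon N T S \<longleftrightarrow> S \<subseteq> {..<N} \<and> 3 \<le> card S \<and>
     (\<forall>x y. adj S x y \<longrightarrow> is_edge N T x y) \<and>
     (\<forall>d\<in>T. d \<subseteq> S \<longrightarrow> (\<exists>x y. d = {x, y} \<and> adj S x y))"
proof (cases "S \<subseteq> {..<N} \<and> 3 \<le> card S")
  case True
  then have "finite S" using finite_subset by blast
  have ex: "(\<exists>a b. {x, y} = {a, b} \<and> is_edge N T a b) \<longleftrightarrow> is_edge N T x y" for x y
    using is_edge_commute by (metis doubleton_eq_iff)
  have cp: "cyc_pairs S = {{x, y} | x y. adj S x y}"
    using True \<open>finite S\<close> by (intro cyc_pairs_eq_adj) auto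
  have "(\<forall>p\<in>cyc_pairs S. P p) \<longleftrightarrow> (\<forall>x y. adj S x y \<longrightarrow> P {x, y})" for P
    unfolding cp by blast
  then have "(\<forall>p\<in>cyc_pairs S. \<exists>a b. p = {a, b} \<and> is_edge N T a b) \<longleftrightarrow> (\<forall>x y. adj S x y \<longrightarrow> is_edge N T x y)"
    by (simp only: ex)
  moreover have "d \<in> cyc_pairs S \<longleftrightarrow> (\<exists>x y. d = {x, y} \<and> adj S x y)" for d
    unfolding cp by blast
  ultimately show ?thesis unfolding is_subgon_def by simp
qed (auto simp: is_subgon_def)

section \<open>Rotation of edges, subgons and angulations\<close>

definition rot :: "nat \<Rightarrow> nat \<Rightarrow> nat" where
  "rot N i = (i + N - 1) mod N"

lemma rot_eq: "i < N \<Longrightarrow> rot N i = (if i = 0 then N - 1 else i - 1)"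
  by (auto simp: rot_def mod_if)

lemma rot_less: "i < N \<Longrightarrow> rot N i < N"
  by (auto simp: rot_def)

lemma inj_on_rot: "inj_on (rot N) {..<N}"
  by (auto simp: inj_on_def rot_eq split: if_splits)

lemma rot_image: "rot N ` {..<N} = {..<N}"
  by (rule endo_inj_surj) (auto simp: inj_on_rot rot_less)

lemma sigma_eq: "sigma N T = (\<lambda>d. rot N ` d) ` T"
  by (simp add: sigma_def rot_def)

lemma rot_image_inj: "S \<subseteq> {..<N} \<Longrightarrow> S' \<subseteq> {..<N} \<Longrightarrow> rot N ` S = rot N ` S' \<longleftrightarrow> S = S'"
  using inj_on_image_eq_iff[OF inj_on_rot] by blast

lemma btw_rot:
  "x < N \<Longrightarrow> y < N \<Longrightarrow> z < N \<Longrightarrow> btw (rot N x) (rot N z) (rot N y) \<longleftrightarrow> btw x z y"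
  by (cases "x = 0"; cases "y = 0"; cases "z = 0") (auto simp: rot_eq btw_def)

lemma adj_rot:
  assumes "S \<subseteq> {..<N}" "x < N" "y < N"
  shows "adj (rot N ` S) (rot N x) (rot N y) \<longleftrightarrow> adj S x y"
proof -
  have "z < N" if "z \<in> S" for z using assms that by auto
  then show ?thesis
    using assms btw_rot inj_on_image_mem_iff[OF inj_on_rot, of _ N S] inj_onD[OF inj_on_rot, of N x y]
    unfolding adj_def by auto
qed

lemma is_side_rot:
  "3 \<le> N \<Longrightarrow> a < N \<Longrightarrow> b < N \<Longrightarrow> is_side N (rot N a) (rot N b) \<longleftrightarrow> is_side N a b"
  by (cases "a = 0"; cases "b = 0") (auto simp: rot_eq is_side_def)

text \<open>\<open>crossing\<close> uses the linear order of labels, and rotation may change which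
  chord starts first. Separation on the circle is the invariant form.\<close>

lemma crossing_btw:
  "crossing {a, b} {c, f} \<longleftrightarrow> (btw a c b \<and> btw b f a) \<or> (btw a f b \<and> btw b c a)"
proof
  assume "crossing {a, b} {c, f}"
  then show "(btw a c b \<and> btw b f a) \<or> (btw a f b \<and> btw b c a)"
    unfolding crossing_def btw_def by (auto simp: doubleton_eq_iff)
next
  have *: "crossing {a, b} {c, f}" if "btw a c b" "btw b f a" "a < b" for a b c f
  proof -
    \<comment> \<open>Going clockwise from \<open>b\<close> to \<open>a\<close>, \<open>f\<close>
      lies beyond \<open>b\<close> or, after the wrap-around, before \<open>a\<close>; in the latter
      case the two chords exchange roles in the definition.\<close>
    have "(a < c \<and> c < b \<and> b < f) \<or> (f < a \<and> a < c \<and> c < b)"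
      using that by (auto simp: btw_def)
    then show ?thesis unfolding crossing_def by (metis insert_commute)
  qed
  assume "(btw a c b \<and> btw b f a) \<or> (btw a f b \<and> btw b c a)"
  moreover have "a \<noteq> b" if "btw a c b" for a b c using that by (auto simp: btw_def)
  ultimately show "crossing {a, b} {c, f}"
    using *[of a c b f] *[of a f b c] *[of b c a f] *[of b f a c]
    by (metis insert_commute linorder_neqE_nat)
qed

lemma is_diagonal_obtain:
  assumes "is_diagonal N d" obtains a b where "d = {a, b}" "a < N" "b < N" "a \<noteq> b" "\<not> is_side N a b"
  using assms unfolding is_diagonal_def by (metis less_trans less_irrefl)

lemma is_diagonal_intro:
  "a < N \<Longrightarrow> b < N \<Longrightarrow> a \<noteq> b \<Longrightarrow> \<not> is_side N a b \<Longrightarrow> is_diagonal N {a, b}"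
proof -
  have *: "is_side N a b \<longleftrightarrow> is_side N b a" "{a, b} = {b, a}"
    by (auto simp: is_side_def)
  assume "a < N" "b < N" "a \<noteq> b" "\<not> is_side N a b"
  then show ?thesis
    unfolding is_diagonal_def by (metis * linorder_neqE_nat)
qed

lemma is_edge_sigma:
  assumes "3 \<le> N" "\<forall>d\<in>T. is_diagonal N d" "a < N" "b < N"
  shows "is_edge N (sigma N T) (rot N a) (rot N b) \<longleftrightarrow> is_edge N T a b"
proof -
  have "d \<subseteq> {..<N}" if "d \<in> T" for d
    using is_diagonal_obtain[of N d] that assms by blast
  then have "{rot N a, rot N b} \<in> sigma N T \<longleftrightarrow> {a, b} \<in> T"
    using rot_image_inj[of "{a, b}" N] assms(3,4) by (auto simp: sigma_eq image_iff)
  then show ?thesis using assms by (simp add: is_edge_def is_side_rot)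
qed

lemma card_rot: "S \<subseteq> {..<N} \<Longrightarrow> card (rot N ` S) = card S"
  by (meson card_image inj_on_rot inj_on_subset)

lemma is_subgon_sigma:
  assumes N: "3 \<le> N" and T: "\<forall>d\<in>T. is_diagonal N d" and S: "S \<subseteq> {..<N}"
  shows "is_subgon N (sigma N T) (rot N ` S) \<longleftrightarrow> is_subgon N T S"
proof -
  have T': "d \<subseteq> {..<N}" if "d \<in> T" for d
    using is_diagonal_obtain[of N d] that assms by blast
  have "(\<forall>x y. adj (rot N ` S) x y \<longrightarrow> is_edge N (sigma N T) x y) \<longleftrightarrow>
    (\<forall>x\<in>S. \<forall>y\<in>S. adj (rot N ` S) (rot N x) (rot N y) \<longrightarrow> is_edge N (sigma N T) (rot N x) (rot N y))"
    unfolding adj_def by blast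
  also have "\<dots> \<longleftrightarrow> (\<forall>x\<in>S. \<forall>y\<in>S. adj S x y \<longrightarrow> is_edge N T x y)"
    using S by (intro ball_cong) (auto simp: adj_rot is_edge_sigma[OF N T] subset_iff)
  also have "\<dots> \<longleftrightarrow> (\<forall>x y. adj S x y \<longrightarrow> is_edge N T x y)"
    unfolding adj_def by blast
  finally have 1: "(\<forall>x y. adj (rot N ` S) x y \<longrightarrow> is_edge N (sigma N T) x y) \<longleftrightarrow>
    (\<forall>x y. adj S x y \<longrightarrow> is_edge N T x y)" .
  have 2: "(\<exists>x y. rot N ` d = {x, y} \<and> adj (rot N ` S) x y) \<longleftrightarrow> (\<exists>x y. d = {x, y} \<and> adj S x y)"
    if "d \<in> T" for d
  proof
    assume "\<exists>x y. rot N ` d = {x, y} \<and> adj (rot N ` S) x y"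
    then obtain x y where xy: "rot N ` d = {x, y}" "adj (rot N ` S) x y" by blast
    then obtain x' y' where x': "x = rot N x'" "y = rot N y'" "x' \<in> S" "y' \<in> S"
      unfolding adj_def by blast
    with S have "x' < N" "y' < N" by auto
    then have "d = {x', y'}" "adj S x' y'"
      using rot_image_inj[OF T'[OF that], of "{x', y'}"] xy x' adj_rot[OF S, of x' y'] by auto
    then show "\<exists>x y. d = {x, y} \<and> adj S x y" by blast
  next
    assume "\<exists>x y. d = {x, y} \<and> adj S x y"
    then obtain x y where xy: "d = {x, y}" "adj S x y" by blast
    then have "x < N" "y < N" using S by (auto simp: adj_def)
    then show "\<exists>x y. rot N ` d = {x, y} \<and> adj (rot N ` S) x y"
      using xy adj_rot[OF S, of x y] by (intro exI[of _ "rot N x"] exI[of _ "rot N y"]) auto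
  qed
  have 3: "rot N ` d \<subseteq> rot N ` S \<longleftrightarrow> d \<subseteq> S" if "d \<in> T" for d
    using inj_on_image_mem_iff[OF inj_on_rot, of _ N S] T'[OF that] S
    unfolding image_subset_iff by (meson subset_iff)
  have "rot N ` S \<subseteq> {..<N}" using S rot_image by blast
  then show ?thesis
    unfolding is_subgon_iff using S 1 2 3 by (simp add: card_rot sigma_eq)
qed

lemma subgons_subset: "Q \<in> subgons N T \<Longrightarrow> Q \<subseteq> {..<N}"
  by (simp add: subgons_def is_subgon_def)

lemma subgons_sigma:
  assumes "3 \<le> N" "\<forall>d\<in>T. is_diagonal N d"
  shows "subgons N (sigma N T) = (\<lambda>S. rot N ` S) ` subgons N T"
proof (intro set_eqI iffI)
  fix Q assume Q: "Q \<in> subgons N (sigma N T)"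
  then have "Q \<subseteq> rot N ` {..<N}" using subgons_subset rot_image by metis
  then obtain S where "S \<subseteq> {..<N}" "Q = rot N ` S" by (auto simp: subset_image_iff)
  then show "Q \<in> (\<lambda>S. rot N ` S) ` subgons N T"
    using Q is_subgon_sigma[OF assms] by (auto simp: subgons_def)
next
  fix Q assume "Q \<in> (\<lambda>S. rot N ` S) ` subgons N T"
  then show "Q \<in> subgons N (sigma N T)"
    using is_subgon_sigma[OF assms] subgons_subset by (auto simp: subgons_def)
qed

text \<open>Makes all facts about angulations available for the rotated one, notably in the
  induction for \<open>inj_on_ccw_key\<close>.\<close>

lemma is_angulation_sigma:
  assumes N: "3 \<le> N" and T: "is_angulation N m T"
  shows "is_angulation N m (sigma N T)"
proof -
  have diag: "\<forall>d\<in>T. is_diagonal N d" using T by (simp add: is_angulation_def)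
  have "is_diagonal N (rot N ` d)" if d: "d \<in> T" for d
  proof -
    obtain a b where "d = {a, b}" "a < N" "b < N" "a \<noteq> b" "\<not> is_side N a b"
      using is_diagonal_obtain diag d by metis
    then show ?thesis
      using is_diagonal_intro[of "rot N a" N "rot N b"] inj_onD[OF inj_on_rot, of N a b]
      by (auto simp: rot_less is_side_rot[OF N])
  qed
  moreover have "\<not> crossing (rot N ` d) (rot N ` e)" if d: "d \<in> T" and e: "e \<in> T" for d e
  proof -
    obtain a b where "d = {a, b}" "a < N" "b < N" using is_diagonal_obtain diag d by metis
    moreover obtain c f where "e = {c, f}" "c < N" "f < N" using is_diagonal_obtain diag e by metis
    moreover have "\<not> crossing d e" using T d e by (simp add: is_angulation_def)
    ultimately show ?thesis by (simp add: crossing_btw btw_rot)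
  qed
  moreover have "card S = m + 2" if "S \<in> subgons N (sigma N T)" for S
    using that T subgons_subset[of _ N T]
    by (auto simp: subgons_sigma[OF N diag] is_angulation_def card_rot)
  ultimately show ?thesis unfolding is_angulation_def by (simp add: sigma_eq)
qed

subsection \<open>Subgons at a vertex\<close>

locale angulation =
  fixes N m :: nat and T :: "nat set set"
  assumes N: "3 \<le> N" and angulation: "is_angulation N m T"
begin

section \<open>Edges, chords and gaps of a subgon\<close>

lemma diagonal: "d \<in> T \<Longrightarrow> is_diagonal N d"
  using angulation by (simp add: is_angulation_def)

lemma subgon_card: "Q \<in> subgons N T \<Longrightarrow> card Q = m + 2"
  using angulation by (simp add: is_angulation_def)

lemma subgon_card_ge: "Q \<in> subgons N T \<Longrightarrow> 3 \<le> card Q"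
  by (simp add: subgons_def is_subgon_def)

lemma subgon_less: "Q \<in> subgons N T \<Longrightarrow> x \<in> Q \<Longrightarrow> x < N"
  using subgons_subset by fastforce

lemma subgon_finite: "Q \<in> subgons N T \<Longrightarrow> finite Q"
  by (rule finite_subset[OF subgons_subset]) simp_all

lemma subgons_finite: "finite (subgons N T)"
  by (rule finite_subset[of _ "Pow {..<N}"]) (auto dest: subgons_subset)

text \<open>Each pair separates the other strictly, so neither can be a side, not even the side from
  0 to \<open>N - 1\<close>; both are diagonals of \<open>T\<close>.\<close>

lemma edges_noncrossing:
  assumes "is_edge N T a b" "is_edge N T c d" "a < c" "c < b" "b < d" "d < N"
  shows False
proof -
  have "{a, b} \<in> T" "{c, d} \<in> T"
    using assms by (auto simp: is_edge_def is_side_def)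
  then have "\<not> crossing {a, b} {c, d}"
    using angulation by (simp add: is_angulation_def)
  then show False using assms unfolding crossing_def by blast
qed

lemma subgon_edge_gap:
  assumes "Q \<in> subgons N T" "x \<in> Q" "y \<in> Q" "x < y" "\<forall>z\<in>Q. z \<le> x \<or> y \<le> z"
  shows "is_edge N T x y"
proof -
  have "adj Q x y" using assms by (simp add: adj_less)
  then show ?thesis using assms(1) by (auto simp: subgons_def is_subgon_iff)
qed

lemma subgon_edge_ends:
  assumes "Q \<in> subgons N T" "x \<in> Q" "y \<in> Q" "x < y" "\<forall>z\<in>Q. x \<le> z \<and> z \<le> y"
  shows "is_edge N T x y"
proof -
  have "adj Q x y" using assms by (simp add: adj_less)
  then show ?thesis using assms(1) by (auto simp: subgons_def is_subgon_iff)
qed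

text \<open>For diagonals this is part of being a subgon. A side either leaves no label strictly
  between its ends or encloses all labels.\<close>

lemma subgon_chord:
  assumes Q: "Q \<in> subgons N T" and xy: "x \<in> Q" "y \<in> Q" "x < y" "is_edge N T x y"
  shows "(\<forall>z\<in>Q. z \<le> x \<or> y \<le> z) \<or> (\<forall>z\<in>Q. x \<le> z \<and> z \<le> y)"
proof (cases "is_side N x y")
  case True
  then have "y = x + 1 \<or> (x = 0 \<and> y = N - 1)" using xy by (auto simp: is_side_def)
  then show ?thesis using subgon_less[OF Q] by fastforce
next
  case False
  then have "{x, y} \<in> T" "{x, y} \<subseteq> Q" using xy by (auto simp: is_edge_def)
  then obtain a b where "{x, y} = {a, b}" "adj Q a b"
    using Q unfolding subgons_def is_subgon_iff by blast
  then have "adj Q x y" using adj_commute by (metis doubleton_eq_iff)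
  then show ?thesis using xy(3) by (simp add: adj_less)
qed

text \<open>The nearest vertices of \<open>Q\<close> on both sides of \<open>w\<close> are
  consecutive and hence joined by a boundary edge.\<close>

lemma subgon_gap:
  assumes Q: "Q \<in> subgons N T" and xy: "x \<in> Q" "y \<in> Q" "x < w" "w < y" "w \<notin> Q"
  obtains a b where "a \<in> Q" "b \<in> Q" "x \<le> a" "a < w" "w < b" "b \<le> y" "is_edge N T a b"
    "\<forall>z\<in>Q. z \<le> a \<or> b \<le> z"
proof -
  define A B where "A = {z \<in> Q. z < w}" and "B = {z \<in> Q. w < z}"
  have fin: "finite A" "finite B" using subgon_finite[OF Q] by (auto simp: A_def B_def)
  have "x \<in> A" "y \<in> B" using xy by (auto simp: A_def B_def)
  then have "Max A \<in> A" "x \<le> Max A" "Min B \<in> B" "Min B \<le> y"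
    using fin by (auto intro: Max_in Min_in)
  moreover have gap: "\<forall>z\<in>Q. z \<le> Max A \<or> Min B \<le> z"
  proof
    fix z assume "z \<in> Q"
    moreover have "z \<noteq> w" using \<open>z \<in> Q\<close> xy by blast
    ultimately have "z \<in> A \<or> z \<in> B" by (auto simp: A_def B_def)
    then show "z \<le> Max A \<or> Min B \<le> z" using fin by auto
  qed
  moreover have "is_edge N T (Max A) (Min B)"
    using calculation by (intro subgon_edge_gap[OF Q]) (auto simp: A_def B_def)
  ultimately show ?thesis by (intro that[of "Max A" "Min B"]) (auto simp: A_def B_def)
qed

lemma subgon_le_Max: "Q \<in> subgons N T \<Longrightarrow> x \<in> Q \<Longrightarrow> x \<le> Max Q"
  by (simp add: subgon_finite)

lemma subgon_nonempty: "Q \<in> subgons N T \<Longrightarrow> Q \<noteq> {}"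
  using subgon_card_ge by fastforce

lemma subgon_Max_in: "Q \<in> subgons N T \<Longrightarrow> Max Q \<in> Q"
  by (simp add: subgon_finite subgon_nonempty)

lemma subgon_Min_in: "Q \<in> subgons N T \<Longrightarrow> Min Q \<in> Q"
  by (simp add: subgon_finite subgon_nonempty)

lemma subgon_not_subset_pair:
  assumes "Q \<in> subgons N T" shows "\<not> Q \<subseteq> {a, b}"
proof
  assume "Q \<subseteq> {a, b}"
  then have "card Q \<le> card {a, b}" by (intro card_mono) auto
  also have "\<dots> \<le> 2" by (simp add: card_insert_if)
  finally show False using subgon_card_ge[OF assms] by simp
qed

lemma subgon_Min_less_Max:
  assumes "Q \<in> subgons N T" shows "Min Q < Max Q"
proof (rule ccontr)
  assume "\<not> Min Q < Max Q"
  then have "Q \<subseteq> {Min Q, Min Q}"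
    using subgon_finite[OF assms] by (metis Max_ge Min_le antisym insertI1 le_less_trans not_le subsetI order.trans)
  then show False using subgon_not_subset_pair[OF assms] by blast
qed

text \<open>At the first difference \<open>z\<close>, a boundary edge of \<open>Q'\<close> passes
  over \<open>z\<close>. Its left end is also in \<open>Q\<close>; the edge then either crosses an
  edge of \<open>Q\<close> or degenerates \<open>Q'\<close>.\<close>

lemma subgon_unique_aux:
  assumes Q: "Q \<in> subgons N T" "0 \<in> Q" and Q': "Q' \<in> subgons N T" "0 \<in> Q'"
    and Max: "Max Q = Max Q'"
    and z: "z \<in> Q" "z \<notin> Q'" "\<forall>y<z. y \<in> Q \<longleftrightarrow> y \<in> Q'"
  shows False
proof -
  define M where "M = Max Q"
  have M: "M \<in> Q" "M \<in> Q'" using subgon_Max_in[OF Q(1)] subgon_Max_in[OF Q'(1)] Max by (auto simp: M_def)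
  have le: "y \<le> M" if "y \<in> Q \<or> y \<in> Q'" for y
    using that subgon_le_Max[OF Q(1)] subgon_le_Max[OF Q'(1)] Max by (auto simp: M_def)
  have "z \<noteq> 0" "z \<noteq> M" using z Q' M by metis+
  then have "0 < z" "z < M" using le[of z] z by auto
  then obtain x w where xw: "x \<in> Q'" "w \<in> Q'" "x < z" "z < w" "w \<le> M" "is_edge N T x w"
    "\<forall>z\<in>Q'. z \<le> x \<or> w \<le> z"
    using subgon_gap[OF Q'(1) Q'(2) M(2) _ _ z(2)] by metis
  have "x \<in> Q" using z xw by blast
  show False
  proof (cases "w \<in> Q")
    case False
    then have "w < M" using xw M by (metis le_neq_implies_less)
    \<comment> \<open>The edge of \<open>Q\<close> over \<open>w\<close> starts at or after
      \<open>z\<close>, strictly between \<open>x\<close> and \<open>w\<close>, and so crosses the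
      edge from \<open>x\<close> to \<open>w\<close>.\<close>
    then obtain a b where "a \<in> Q" "b \<in> Q" "z \<le> a" "a < w" "w < b" "is_edge N T a b"
      using subgon_gap[OF Q(1) z(1) M(1) xw(4) _ False] by metis
    then show False using edges_noncrossing[of x w a b] xw subgon_less[OF Q(1)] by auto
  next
    case True
    \<comment> \<open>Here the edge from \<open>x\<close> to \<open>w\<close> is a chord of
      \<open>Q\<close> with \<open>z\<close> under it, so it can only join 0 and the maximum;
      \<open>Q'\<close> is left with two vertices.\<close>
    then have "\<forall>y\<in>Q. x \<le> y \<and> y \<le> w"
      using subgon_chord[OF Q(1) \<open>x \<in> Q\<close> True] xw z(1) by (metis leD less_trans)
    then have "x = 0" "w = M" using Q M xw by auto
    then have "Q' \<subseteq> {0, M}" using xw le by (auto simp: antisym)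
    then show False using subgon_not_subset_pair[OF Q'(1)] by blast
  qed
qed

lemma inj_on_Max: "inj_on Max {Q \<in> subgons N T. 0 \<in> Q}"
proof (rule inj_onI, rule ccontr, clarsimp)
  fix Q Q' assume *: "Q \<in> subgons N T" "0 \<in> Q" "Q' \<in> subgons N T" "0 \<in> Q'" "Max Q = Max Q'" "Q \<noteq> Q'"
  define z where "z = (LEAST z. (z \<in> Q) \<noteq> (z \<in> Q'))"
  have "\<exists>z. (z \<in> Q) \<noteq> (z \<in> Q')" using * by blast
  then have z: "(z \<in> Q) \<noteq> (z \<in> Q')" unfolding z_def by (rule LeastI_ex)
  have least: "y \<in> Q \<longleftrightarrow> y \<in> Q'" if "y < z" for y
    using not_less_Least[of y] that unfolding z_def by blast
  show False
  proof (cases "z \<in> Q")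
    case True
    then show False using z least by (intro subgon_unique_aux[OF *(1-5), of z]) auto
  next
    case False
    then show False using z least by (intro subgon_unique_aux[OF *(3,4,1,2) *(5)[symmetric], of z]) auto
  qed
qed

text \<open>Among the cycles of edges through 0 and \<open>a\<close> on labels up to
  \<open>a\<close>, one with fewest vertices is a subgon: a diagonal across it would be a
  shortcut.\<close>

lemma subgon_exists:
  assumes a: "2 \<le> a" "a < N" and e: "is_edge N T 0 a"
  obtains S where "S \<in> subgons N T" "0 \<in> S" "Max S = a"
proof -
  \<comment> \<open>\<open>P\<close> omits the closing edge from 0 to \<open>a\<close>, which is
    supplied by \<open>e\<close>.\<close>
  define P where "P S \<longleftrightarrow> S \<subseteq> {..a} \<and> 0 \<in> S \<and> a \<in> S \<and> 3 \<le> card S \<and>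
    (\<forall>x\<in>S. \<forall>y\<in>S. x < y \<longrightarrow> (\<forall>z\<in>S. z \<le> x \<or> y \<le> z) \<longrightarrow> is_edge N T x y)" for S
  have "y = Suc x" if "x < y" "y \<le> a" "\<forall>z\<in>{..a}. z \<le> x \<or> y \<le> z" for x y
    using that(1,2) bspec[OF that(3), of "Suc x"] by simp
  \<comment> \<open>Consecutive labels span sides, so there is at least one candidate to minimise
    over.\<close>
  then have "P {..a}"
    using a unfolding P_def is_edge_def is_side_def by fastforce
  then obtain S where S: "P S" and min: "\<And>S'. P S' \<Longrightarrow> card S \<le> card S'"
    using ex_has_least_nat[of P "{..a}" card] by blast
  have S': "S \<subseteq> {..a}" "0 \<in> S" "a \<in> S" "3 \<le> card S"
    and gap: "\<And>x y. x \<in> S \<Longrightarrow> y \<in> S \<Longrightarrow> x < y \<Longrightarrow> \<forall>z\<in>S. z \<le> x \<or> y \<le> z \<Longrightarrow> is_edge N T x y"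
    using S unfolding P_def by blast+
  have fin: "finite S" using finite_subset[OF S'(1)] by simp
  have adj: "adj S x y \<longleftrightarrow> x \<in> S \<and> y \<in> S \<and> ((\<forall>z\<in>S. z \<le> x \<or> y \<le> z) \<or> (x = 0 \<and> y = a))"
    if "x < y" for x y
  proof -
    have "(\<forall>z\<in>S. x \<le> z \<and> z \<le> y) \<longleftrightarrow> x = 0 \<and> y = a" if "x \<in> S" "y \<in> S"
      using that S'(1-3) by fastforce
    then show ?thesis unfolding adj_less[OF that] by blast
  qed
  have edge: "is_edge N T x y" if "adj S x y" "x < y" for x y
    using that(1) gap[OF _ _ that(2)] e unfolding adj[OF that(2)] by metis
  have chord: "adj S x y" if d: "{x, y} \<in> T" "x \<in> S" "y \<in> S" "x < y" for x y
  proof (rule ccontr)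
    assume "\<not> adj S x y"
    then obtain w where w: "w \<in> S" "x < w" "w < y" and out: "\<not> (x = 0 \<and> y = a)"
      using adj[OF d(4)] d(2,3) by (meson not_le)
    \<comment> \<open>The shortcut along the diagonal drops all vertices strictly under it, among
      them \<open>w\<close>.\<close>
    define S1 where "S1 = {z \<in> S. z \<le> x \<or> y \<le> z}"
    have "w \<notin> S1" "S1 \<subseteq> S" using w by (auto simp: S1_def)
    then have "S1 \<subset> S" using w(1) by blast
    then have "card S1 < card S" using fin by (rule psubset_card_mono[rotated])
    moreover have "P S1" unfolding P_def
    proof (intro conjI ballI impI)
      show "S1 \<subseteq> {..a}" "0 \<in> S1" "a \<in> S1" using S' d by (auto simp: S1_def)
      \<comment> \<open>Since \<open>x\<close> and \<open>y\<close> are not 0 and \<open>a\<close>,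
        one of 0 and \<open>a\<close> serves as a third vertex.\<close>
      obtain v where "v \<in> S1" "v \<noteq> x" "v \<noteq> y"
        using out d \<open>0 \<in> S1\<close> \<open>a \<in> S1\<close> S'(1) by (metis atMost_iff le_zero_eq not_le subsetD)
      then have "{v, x, y} \<subseteq> S1" "card {v, x, y} = 3" using d by (auto simp: S1_def)
      then show "3 \<le> card S1" using card_mono[of S1 "{v, x, y}"] fin by (simp add: S1_def)
    next
      fix u v assume uv: "u \<in> S1" "v \<in> S1" "u < v" "\<forall>z\<in>S1. z \<le> u \<or> v \<le> z"
      show "is_edge N T u v"
      proof (cases "\<forall>z\<in>S. z \<le> u \<or> v \<le> z")
        case True
        then show ?thesis using uv gap by (simp add: S1_def)
      next
        case False
        then obtain z where z: "z \<in> S" "u < z" "z < v" by auto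
        then have "z \<notin> S1" using uv(4) by auto
        then have "x < z" "z < y" using z by (auto simp: S1_def)
        moreover have "x \<in> S1" "y \<in> S1" using d by (auto simp: S1_def)
        \<comment> \<open>A gap of \<open>S1\<close> that is not a gap of \<open>S\<close> can only
          be the one under the diagonal.\<close>
        ultimately have "u = x" "v = y" using uv z unfolding S1_def by fastforce+
        then show ?thesis using d by (simp add: is_edge_def)
      qed
    qed
    ultimately show False using min by fastforce
  qed
  have "is_subgon N T S" unfolding is_subgon_iff
  proof (intro conjI allI impI ballI)
    show "S \<subseteq> {..<N}" using S'(1) a by auto
    show "3 \<le> card S" by fact
    show "is_edge N T x y" if "adj S x y" for x y
      using that edge[of x y] edge[of y x] adj_commute is_edge_commute
      by (metis adj_def linorder_neqE_nat)
    show "\<exists>x y. d = {x, y} \<and> adj S x y" if d: "d \<in> T" "d \<subseteq> S" for d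
    proof -
      obtain x y where "d = {x, y}" "x < y"
        using diagonal[OF d(1)] unfolding is_diagonal_def by blast
      then show ?thesis using chord[of x y] d by auto
    qed
  qed
  moreover have "Max S = a" using S' fin by (intro Max_eqI) auto
  ultimately show ?thesis using S' that by (simp add: subgons_def)
qed
text \<open>Each subgon at 0 lies between two consecutive neighbours of 0, namely its second smallest
  vertex and its maximum.\<close>

definition fan :: "nat set set" where
  "fan = {Q \<in> subgons N T. 0 \<in> Q}"

definition nbrs :: "nat set" where
  "nbrs = {a. 0 < a \<and> a < N \<and> is_edge N T 0 a}"

definition sec :: "nat set \<Rightarrow> nat" where
  "sec Q = Min (Q - {0})"

lemma nbrs_ends: "1 \<in> nbrs" "N - 1 \<in> nbrs"
  using N by (auto simp: nbrs_def is_edge_def is_side_def)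

lemma finite_nbrs: "finite nbrs"
  by (rule finite_subset[of _ "{..<N}"]) (auto simp: nbrs_def)

lemma finite_fan: "finite fan"
  using subgons_finite by (simp add: fan_def)

lemma fan_sec:
  assumes "Q \<in> fan"
  shows "sec Q \<in> Q" "0 < sec Q" "\<And>z. z \<in> Q \<Longrightarrow> z = 0 \<or> sec Q \<le> z" "sec Q < Max Q"
proof -
  have Q: "Q \<in> subgons N T" "0 \<in> Q" using assms by (auto simp: fan_def)
  then have fin: "finite (Q - {0})" using subgon_finite by auto
  have "Q - {0} \<noteq> {}" using subgon_not_subset_pair[OF Q(1), of 0 0] by auto
  with fin have "Min (Q - {0}) \<in> Q - {0}" by (rule Min_in)
  then show 1: "sec Q \<in> Q" "0 < sec Q" by (auto simp: sec_def)
  show 2: "z = 0 \<or> sec Q \<le> z" if "z \<in> Q" for z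
    using fin that unfolding sec_def by (cases "z = 0") auto
  have "\<not> Q \<subseteq> {0, sec Q}" using subgon_not_subset_pair Q by blast
  then obtain z where "z \<in> Q" "z \<noteq> 0" "z \<noteq> sec Q" by auto
  then show "sec Q < Max Q" using 2[of z] subgon_le_Max[OF Q(1), of z] by auto
qed

lemma fan_Min: "Q \<in> fan \<Longrightarrow> Min Q = 0"
  by (auto simp: fan_def subgon_finite intro!: Min_eqI)

lemma fan_Max_nbr: assumes "Q \<in> fan" shows "Max Q \<in> nbrs - {1}"
proof -
  have Q: "Q \<in> subgons N T" "0 \<in> Q" using assms by (auto simp: fan_def)
  have "is_edge N T 0 (Max Q)"
    using fan_sec(2,4)[OF assms] subgon_le_Max[OF Q(1)]
    by (intro subgon_edge_ends[OF Q subgon_Max_in[OF Q(1)]]) auto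
  then show ?thesis using fan_sec(2,4)[OF assms] subgon_less[OF Q(1) subgon_Max_in[OF Q(1)]]
    by (auto simp: nbrs_def)
qed

lemma fan_sec_nbr: assumes "Q \<in> fan" shows "sec Q \<in> nbrs - {N - 1}"
proof -
  have Q: "Q \<in> subgons N T" "0 \<in> Q" using assms by (auto simp: fan_def)
  have "is_edge N T 0 (sec Q)"
    using fan_sec(2,3)[OF assms] by (intro subgon_edge_gap[OF Q fan_sec(1)[OF assms]]) auto
  then show ?thesis using fan_sec(2,4)[OF assms] subgon_less[OF Q(1) subgon_Max_in[OF Q(1)]]
    by (auto simp: nbrs_def)
qed

text \<open>An edge from 0 ending strictly between would be a forbidden chord if \<open>a\<close> is
  in \<open>Q\<close>, and otherwise would cross the boundary edge of \<open>Q\<close> over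
  \<open>a\<close>.\<close>

lemma fan_nbr_side:
  assumes Q: "Q \<in> fan" and a: "a \<in> nbrs"
  shows "a \<le> sec Q \<or> Max Q \<le> a"
proof (rule ccontr)
  assume "\<not> (a \<le> sec Q \<or> Max Q \<le> a)"
  then have *: "sec Q < a" "a < Max Q" by auto
  have Q': "Q \<in> subgons N T" "0 \<in> Q" using Q by (auto simp: fan_def)
  have e: "is_edge N T 0 a" "0 < a" using a by (auto simp: nbrs_def)
  have "a \<notin> Q"
    using subgon_chord[OF Q' _ e(2,1)] fan_sec(1,2)[OF Q] subgon_Max_in[OF Q'(1)] *
    by (metis leD)
  then obtain x y where "x \<in> Q" "y \<in> Q" "sec Q \<le> x" "x < a" "a < y" "is_edge N T x y"
    using subgon_gap[OF Q'(1) fan_sec(1)[OF Q] subgon_Max_in[OF Q'(1)] *] by metis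
  then show False
    using edges_noncrossing[of 0 a x y] e fan_sec(2)[OF Q] subgon_less[OF Q'(1)] by auto
qed

lemma bij_betw_fan_Max: "bij_betw Max fan (nbrs - {1})"
  unfolding bij_betw_def
proof (intro conjI subset_antisym)
  show "inj_on Max fan" using inj_on_Max by (simp add: fan_def)
  show "Max ` fan \<subseteq> nbrs - {1}" by (rule image_subsetI) (rule fan_Max_nbr)
  show "nbrs - {1} \<subseteq> Max ` fan"
  proof
    fix a assume a: "a \<in> nbrs - {1}"
    then have "2 \<le> a" "a < N" "is_edge N T 0 a" by (auto simp: nbrs_def)
    then obtain S where "S \<in> subgons N T" "0 \<in> S" "Max S = a" by (rule subgon_exists)
    then show "a \<in> Max ` fan" by (auto simp: fan_def)
  qed
qed

text \<open>Given \<open>a\<close>, let \<open>b\<close> be the next neighbour of 0. The subgon with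
  maximum \<open>b\<close> has its second vertex at or before \<open>a\<close>, and by
  \<open>fan_nbr_side\<close> not before \<open>a\<close>.\<close>

lemma bij_betw_fan_sec: "bij_betw sec fan (nbrs - {N - 1})"
proof -
  have "nbrs - {N - 1} \<subseteq> sec ` fan"
  proof
    fix a assume a: "a \<in> nbrs - {N - 1}"
    define b where "b = Min {b \<in> nbrs. a < b}"
    have "N - 1 \<in> {b \<in> nbrs. a < b}" using a nbrs_ends by (auto simp: nbrs_def)
    then have "b \<in> {b \<in> nbrs. a < b}"
      unfolding b_def using finite_nbrs by (intro Min_in) auto
    then have b: "b \<in> nbrs" "a < b" by auto
    have min: "b \<le> c" if "c \<in> nbrs" "a < c" for c
      unfolding b_def using finite_nbrs that by (intro Min_le) auto
    have "b \<in> nbrs - {1}" using b a by (auto simp: nbrs_def)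
    then obtain Q where Q: "Q \<in> fan" "Max Q = b"
      using bij_betw_fan_Max unfolding bij_betw_def by (metis imageE)
    have "sec Q < b" using fan_sec[OF Q(1)] Q by auto
    then have "sec Q \<le> a" using min[of "sec Q"] fan_sec_nbr[OF Q(1)] by (meson DiffD1 not_le)
    moreover have "a \<le> sec Q" using fan_nbr_side[OF Q(1), of a] a b Q by auto
    ultimately show "a \<in> sec ` fan" using Q by auto
  qed
  moreover have "sec ` fan \<subseteq> nbrs - {N - 1}" by (rule image_subsetI) (rule fan_sec_nbr)
  ultimately have img: "sec ` fan = nbrs - {N - 1}" by (rule subset_antisym[rotated])
  \<comment> \<open>Injectivity by counting: \<open>nbrs - {1}\<close> and
    \<open>nbrs - {N - 1}\<close> have equal size, so \<open>fan\<close> is as large as its image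
    under \<open>sec\<close>.\<close>
  have "card fan = card (nbrs - {1})" by (rule bij_betw_same_card[OF bij_betw_fan_Max])
  also have "\<dots> = card (nbrs - {N - 1})" using nbrs_ends finite_nbrs by simp
  finally have "inj_on sec fan"
    using img finite_fan by (metis eq_card_imp_inj_on)
  then show ?thesis using img by (simp add: bij_betw_def)
qed

text \<open>Otherwise the edge joining the extreme vertices of \<open>Q\<close> would cross the edge
  from 0 to \<open>a\<close>.\<close>

lemma nbr_inside_subgon:
  assumes Q: "Q \<in> subgons N T" and a: "a \<in> nbrs" "Min Q < a" "a < Max Q"
  shows "0 \<in> Q"
proof (rule ccontr)
  assume "0 \<notin> Q"
  then have "0 < Min Q" using subgon_Min_in[OF Q] by (metis gr0I)
  moreover have "is_edge N T (Min Q) (Max Q)"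
    using subgon_Min_less_Max[OF Q] subgon_Min_in[OF Q] subgon_Max_in[OF Q] subgon_finite[OF Q]
    by (intro subgon_edge_ends[OF Q]) auto
  ultimately show False
    using edges_noncrossing[of 0 a "Min Q" "Max Q"] a subgon_less[OF Q subgon_Max_in[OF Q]]
    by (auto simp: nbrs_def)
qed

end

section \<open>The counterclockwise order of subgons at a vertex\<close>

lemma ccw_key_rot:
  assumes "Q \<subseteq> {..<N}" "i \<in> Q"
  shows "ccw_key N (rot N i) (rot N ` Q) = ccw_key N i Q"
proof -
  have "rot N ` Q - {rot N i} = rot N ` (Q - {i})"
    using inj_on_image_set_diff[OF inj_on_rot, of Q "{i}" N] assms by auto
  moreover have "(rot N j + N - rot N i) mod N = (j + N - i) mod N" if "j \<in> Q" for j
  proof -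
    have "i < N" "j < N" using that assms by auto
    then show ?thesis by (cases "i = 0"; cases "j = 0") (auto simp: rot_eq mod_if)
  qed
  ultimately show ?thesis unfolding ccw_key_def by (simp add: image_image)
qed

text \<open>At vertex 0 the key is the maximum and \<open>inj_on_Max\<close> applies; other vertices
  are rotated to 0, hence \<open>T\<close> arbitrary in the induction. This makes the
  \<open>THE\<close> in \<open>subgons_at\<close> well defined.\<close>

lemma inj_on_ccw_key:
  assumes "3 \<le> N" "is_angulation N m T" "i < N"
  shows "inj_on (ccw_key N i) {Q \<in> subgons N T. i \<in> Q}"
  using assms(2,3)
proof (induction i arbitrary: T)
  case 0
  interpret angulation N m T using assms 0 by unfold_locales
  have "ccw_key N 0 Q = Max Q" if "Q \<in> fan" for Q
  proof -
    have Q: "Q \<in> subgons N T" using that by (simp add: fan_def)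
    have "(\<lambda>j. (j + N - 0) mod N) ` (Q - {0}) = Q - {0}"
      using subgon_less[OF Q] by (force simp: image_iff)
    moreover have "Max (Q - {0}) = Max Q"
      using subgon_finite[OF Q] subgon_Max_in[OF Q] fan_sec[OF that] by (intro Max_eqI) auto
    ultimately show ?thesis unfolding ccw_key_def by simp
  qed
  then show ?case using inj_on_Max by (simp add: fan_def inj_on_def)
next
  case (Suc i)
  then interpret angulation N m T using assms by unfold_locales
  have IH: "inj_on (ccw_key N i) {Q \<in> subgons N (sigma N T). i \<in> Q}"
    using Suc is_angulation_sigma[OF N] by simp
  have rot: "rot N (Suc i) = i" using Suc.prems by (simp add: rot_eq)
  show ?case
  proof (rule inj_onI, clarsimp)
    fix Q Q' assume *: "Q \<in> subgons N T" "Suc i \<in> Q" "Q' \<in> subgons N T" "Suc i \<in> Q'"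
      "ccw_key N (Suc i) Q = ccw_key N (Suc i) Q'"
    then have "ccw_key N i (rot N ` Q) = ccw_key N i (rot N ` Q')"
      using ccw_key_rot[of Q N "Suc i"] ccw_key_rot[of Q' N "Suc i"] subgons_subset by (simp add: rot)
    moreover have "i \<in> rot N ` Q" "i \<in> rot N ` Q'" using * rot by force+
    ultimately have "rot N ` Q = rot N ` Q'"
      using * diagonal by (intro inj_onD[OF IH]) (auto simp: subgons_sigma[OF N])
    then show "Q = Q'" using rot_image_inj * subgons_subset by metis
  qed
qed

subsection \<open>The browse word vertex by vertex\<close>

text \<open>Here \<open>c\<close> counts the earlier visits of the same subgon, so the
  \<open>(m + 2)\<close>-th visit has \<open>c = m + 1\<close>.\<close>

definition emit :: "nat \<Rightarrow> nat \<Rightarrow> letter list" where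
  "emit m c = (if c = 0 then [U] else if c < m + 1 then [R] else [])"

text \<open>The computation of \<open>brow\<close> on an arbitrary visiting list, which allows
  induction on prefixes.\<close>

definition emits :: "nat \<Rightarrow> 'a list \<Rightarrow> letter list" where
  "emits m vs = concat (map (\<lambda>p. emit m (count_list (take p vs) (vs ! p))) [0..<length vs])"

lemma brow_eq_emits: "brow N m T = emits m (visits N T)"
  by (simp add: brow_def emits_def emit_def Let_def)

lemma emits_snoc: "emits m (vs @ [x]) = emits m vs @ emit m (count_list vs x)"
proof -
  define F where "F p = emit m (count_list (take p (vs @ [x])) ((vs @ [x]) ! p))" for p
  have "emits m (vs @ [x]) = concat (map F [0..<length vs]) @ F (length vs)"
    by (simp add: emits_def F_def[abs_def])
  also have "map F [0..<length vs] = map (\<lambda>p. emit m (count_list (take p vs) (vs ! p))) [0..<length vs]"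
    by (rule map_cong) (auto simp: F_def nth_append)
  finally show ?thesis by (simp add: emits_def F_def)
qed

text \<open>In a list \<open>ws\<close> without repetition, earlier visits can only come from
  \<open>vs\<close>.\<close>

lemma emits_append:
  "distinct ws \<Longrightarrow> emits m (vs @ ws) = emits m vs @ concat (map (\<lambda>x. emit m (count_list vs x)) ws)"
proof (induction ws rule: rev_induct)
  case (snoc x ws)
  then show ?case using emits_snoc[of m "vs @ ws" x] by (simp add: count_list_0_iff)
qed simp

lemma card_less_Suc_conj:
  "card {j. j < Suc n \<and> P j} = card {j. j < n \<and> P j} + (if P n then 1 else 0)"
proof -
  have "{j. j < Suc n \<and> P j} = {j. j < n \<and> P j} \<union> (if P n then {n} else {})"
    by (auto simp: less_Suc_eq)
  then show ?thesis by (simp add: card_insert_if)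
qed

lemma count_list_distinct: "distinct xs \<Longrightarrow> count_list xs x = (if x \<in> set xs then 1 else 0)"
  by (induction xs) auto

lemma count_list_concat:
  assumes "\<And>i. i < n \<Longrightarrow> distinct (f i)"
  shows "count_list (concat (map f [0..<n])) x = card {j. j < n \<and> x \<in> set (f j)}"
  using assms
  by (induction n) (simp_all add: card_less_Suc_conj count_list_distinct)

lemma emits_concat:
  assumes "\<And>i. i < n \<Longrightarrow> distinct (f i)"
  shows "emits m (concat (map f [0..<n])) =
    concat (map (\<lambda>i. concat (map (\<lambda>x. emit m (card {j. j < i \<and> x \<in> set (f j)})) (f i))) [0..<n])"
  using assms
  by (induction n) (simp_all add: emits_append count_list_concat, simp add: emits_def)

lemma concat_map_if_single:
  "concat (map (\<lambda>x. if P x then [a] else []) xs) = replicate (length (filter P xs)) a"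
  by (induction xs) auto

lemma filter_sorted_key:
  fixes key :: "'a \<Rightarrow> nat"
  assumes "sorted_wrt (\<lambda>x y. key x > key y) xs" "\<And>x. x \<in> set xs \<Longrightarrow> P x \<longleftrightarrow> c \<le> key x"
  shows "xs = filter P xs @ filter (\<lambda>x. \<not> P x) xs"
  using assms
proof (induction xs)
  case (Cons x xs)
  show ?case
  proof (cases "P x")
    case True
    then show ?thesis using Cons by simp
  next
    case False
    then have "\<not> P y" if "y \<in> set xs" for y using Cons.prems that by fastforce
    then show ?thesis using False by (simp add: filter_empty_conv[THEN iffD2] filter_id_conv[THEN iffD2])
  qed
qed simp

text \<open>The exponent of \<open>R\<close> in the word at \<open>i\<close>; \<open>opens\<close>
  is the exponent of \<open>U\<close>.\<close>

definition passes :: "nat \<Rightarrow> nat set set \<Rightarrow> nat \<Rightarrow> nat" where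
  "passes N T i = card {Q \<in> subgons N T. i \<in> Q \<and> Min Q < i \<and> i < Max Q}"

definition opens :: "nat \<Rightarrow> nat set set \<Rightarrow> nat \<Rightarrow> nat" where
  "opens N T i = card {Q \<in> subgons N T. Min Q = i}"

context angulation
begin

text \<open>As the key is injective, \<open>THE\<close> inverts it, so no subgon is lost or
  repeated.\<close>

lemma subgons_at:
  assumes i: "i < N"
  shows "set (subgons_at N T i) = {Q \<in> subgons N T. i \<in> Q}"
    and "distinct (subgons_at N T i)"
    and "sorted_wrt (\<lambda>x y. ccw_key N i x > ccw_key N i y) (subgons_at N T i)"
proof -
  define G where "G = {Q \<in> subgons N T. i \<in> Q}"
  define g where "g k = (THE Q. Q \<in> subgons N T \<and> i \<in> Q \<and> ccw_key N i Q = k)" for k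
  have inj: "inj_on (ccw_key N i) G"
    using inj_on_ccw_key[OF N angulation i] by (simp add: G_def)
  have g: "g (ccw_key N i Q) = Q" if "Q \<in> G" for Q
    unfolding g_def
  proof (rule the_equality)
    show "Q \<in> subgons N T \<and> i \<in> Q \<and> ccw_key N i Q = ccw_key N i Q"
      using that by (simp add: G_def)
    show "Q' = Q" if "Q' \<in> subgons N T \<and> i \<in> Q' \<and> ccw_key N i Q' = ccw_key N i Q" for Q'
      using that \<open>Q \<in> G\<close> by (intro inj_onD[OF inj]) (auto simp: G_def)
  qed
  define ks where "ks = rev (sorted_list_of_set (ccw_key N i ` G))"
  have fin: "finite (ccw_key N i ` G)" using subgons_finite by (simp add: G_def)
  have at: "subgons_at N T i = map g ks"
    unfolding subgons_at_def g_def G_def ks_def by simp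
  have ks: "set ks = ccw_key N i ` G" "distinct ks" "sorted_wrt (>) ks"
    using fin by (auto simp: ks_def sorted_wrt_rev)
  have "g ` ccw_key N i ` G = G"
    using g by (force simp: image_iff)
  then show "set (subgons_at N T i) = {Q \<in> subgons N T. i \<in> Q}"
    unfolding at by (simp add: ks G_def)
  have key: "ccw_key N i (g k) = k" if "k \<in> set ks" for k
    using that g by (auto simp: ks)
  then show "distinct (subgons_at N T i)"
    unfolding at using ks by (metis distinct_map inj_on_inverseI)
  show "sorted_wrt (\<lambda>x y. ccw_key N i x > ccw_key N i y) (subgons_at N T i)"
    unfolding at sorted_wrt_map using ks(3) by (rule sorted_wrt_mono_rel[rotated]) (simp add: key)
qed

text \<open>The offset of \<open>j\<close> from \<open>i\<close> is \<open>j + N - i\<close>, at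
  least \<open>N - i\<close>, if \<open>j < i\<close>, and \<open>j - i\<close>, less than
  \<open>N - i\<close>, if \<open>i < j\<close>.\<close>

lemma ccw_key_ge_iff:
  assumes Q: "Q \<in> subgons N T" "i \<in> Q"
  shows "Min Q < i \<longleftrightarrow> N - i \<le> ccw_key N i Q"
proof -
  have fin: "finite Q" using subgon_finite Q by simp
  have i: "i < N" using subgon_less Q by simp
  have "Q - {i} \<noteq> {}" using subgon_not_subset_pair[OF Q(1), of i i] by auto
  define offs where "offs = (\<lambda>j. (j + N - i) mod N) ` (Q - {i})"
  have offs: "finite offs" "offs \<noteq> {}" using fin \<open>Q - {i} \<noteq> {}\<close> by (auto simp: offs_def)
  show ?thesis
  proof
    assume *: "Min Q < i"
    have "Min Q \<in> Q" using subgon_Min_in Q by simp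
    then have "(Min Q + N - i) mod N \<in> offs" using * by (auto simp: offs_def)
    then have "(Min Q + N - i) mod N \<le> ccw_key N i Q"
      unfolding ccw_key_def offs_def[symmetric] using offs by simp
    moreover have "(Min Q + N - i) mod N = Min Q + N - i" using * i by simp
    ultimately show "N - i \<le> ccw_key N i Q" by linarith
  next
    assume *: "N - i \<le> ccw_key N i Q"
    have "ccw_key N i Q \<in> offs"
      unfolding ccw_key_def offs_def[symmetric] using offs by simp
    then obtain j where j: "j \<in> Q" "j \<noteq> i" "ccw_key N i Q = (j + N - i) mod N"
      by (auto simp: offs_def)
    have "j < i"
    proof (rule ccontr)
      assume "\<not> j < i"
      then have "j + N - i = j - i + N" "j - i < N" "j - i < N - i"
        using subgon_less[OF Q(1) j(1)] i by linarith+
      then have "(j + N - i) mod N < N - i" by (simp only: mod_add_self2 mod_less)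
      then show False using * j(3) by linarith
    qed
    then show "Min Q < i" using fin j(1) by (meson Min_le le_less_trans)
  qed
qed

text \<open>The earlier visits of \<open>Q\<close> are its vertices below \<open>i\<close>: none at
  the minimum, \<open>m + 1\<close> at the maximum, and between 1 and \<open>m\<close>
  otherwise.\<close>

lemma emit_subgon:
  assumes Q: "Q \<in> subgons N T" "i \<in> Q"
  shows "emit m (card {j. j < i \<and> j \<in> Q}) = (if Min Q = i then [U] else if i < Max Q then [R] else [])"
proof -
  have fin: "finite Q" using subgon_finite Q by simp
  define C where "C = {j. j < i \<and> j \<in> Q}"
  have finC: "finite C" by (simp add: C_def)
  consider "Min Q = i" | "Min Q < i" "i < Max Q" | "Min Q < i" "i = Max Q"
    using fin Q(2) Min_le[OF fin Q(2)] Max_ge[OF fin Q(2)] by linarith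
  then show ?thesis
  proof cases
    case 1
    then have "C = {}" using Min_le[OF fin] by (fastforce simp: C_def)
    then show ?thesis using 1 by (simp add: emit_def C_def)
  next
    case 2
    have "Min Q \<in> C" using 2 subgon_Min_in[OF Q(1)] by (simp add: C_def)
    then have "card C \<noteq> 0" using finC by auto
    have "C \<subseteq> Q - {i, Max Q}" using 2 by (auto simp: C_def)
    then have "card C \<le> card (Q - {i, Max Q})" using fin by (intro card_mono) auto
    also have "\<dots> = m"
      using 2 Q subgon_Max_in[OF Q(1)] subgon_card[OF Q(1)] by (subst card_Diff_subset) auto
    finally show ?thesis using 2 \<open>card C \<noteq> 0\<close> by (simp add: emit_def C_def)
  next
    case 3
    have "C = Q - {Max Q}" using 3 Max_ge[OF fin] unfolding C_def by (auto simp: order.strict_iff_order)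
    then have "card C = m + 1" using subgon_Max_in[OF Q(1)] subgon_card[OF Q(1)] by simp
    then show ?thesis using 3 by (simp add: emit_def C_def)
  qed
qed

text \<open>The counterclockwise order lists the subgons reaching below \<open>i\<close> first,
  which give \<open>R\<close>, or nothing when \<open>i\<close> is their maximum; the others open at
  \<open>i\<close>.\<close>

lemma vertex_word:
  assumes i: "i < N"
  shows "concat (map (\<lambda>Q. emit m (card {j. j < i \<and> Q \<in> set (subgons_at N T j)})) (subgons_at N T i)) =
    replicate (passes N T i) R @ replicate (opens N T i) U"
proof -
  define xs where "xs = subgons_at N T i"
  define A where "A Q \<longleftrightarrow> Min Q < i" for Q
  have xs: "set xs = {Q \<in> subgons N T. i \<in> Q}" "distinct xs"
    using subgons_at[OF i] by (auto simp: xs_def)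
  have split: "xs = filter A xs @ filter (\<lambda>Q. \<not> A Q) xs"
    using subgons_at(3)[OF i] ccw_key_ge_iff subgons_at(1)[OF i] unfolding xs_def A_def
    by (intro filter_sorted_key[of "ccw_key N i" _ _ "N - i"]) auto
  have e: "emit m (card {j. j < i \<and> Q \<in> set (subgons_at N T j)}) =
      (if Min Q = i then [U] else if i < Max Q then [R] else [])" if "Q \<in> set xs" for Q
  proof -
    have "{j. j < i \<and> Q \<in> set (subgons_at N T j)} = {j. j < i \<and> j \<in> Q}"
      using that i by (auto simp: subgons_at xs)
    then show ?thesis using emit_subgon[of Q i] that by (simp add: xs)
  qed
  have le: "Min Q \<le> i" if "Q \<in> set xs" for Q
    using that subgon_finite by (auto simp: xs)
  have eq: "Min Q = i" if "Q \<in> set xs" "\<not> A Q" for Q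
    using le[OF that(1)] that(2) by (simp add: A_def)
  have "map (\<lambda>Q. emit m (card {j. j < i \<and> Q \<in> set (subgons_at N T j)})) (filter A xs) =
    map (\<lambda>Q. if i < Max Q then [R] else []) (filter A xs)"
    by (rule map_cong) (auto simp: e A_def)
  moreover have "length (filter (\<lambda>Q. i < Max Q) (filter A xs)) = passes N T i"
    unfolding passes_def using xs
    by (simp add: distinct_length_filter A_def) (rule arg_cong[where f = card], auto)
  ultimately have 1: "concat (map (\<lambda>Q. emit m (card {j. j < i \<and> Q \<in> set (subgons_at N T j)})) (filter A xs)) =
    replicate (passes N T i) R" by (simp only: concat_map_if_single)
  have "map (\<lambda>Q. emit m (card {j. j < i \<and> Q \<in> set (subgons_at N T j)})) (filter (\<lambda>Q. \<not> A Q) xs) =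
    map (\<lambda>Q. if True then [U] else []) (filter (\<lambda>Q. \<not> A Q) xs)"
    by (rule map_cong) (simp_all add: e eq)
  moreover have "length (filter (\<lambda>Q. True) (filter (\<lambda>Q. \<not> A Q) xs)) = opens N T i"
  proof -
    have "{Q. \<not> A Q} \<inter> set xs = {Q \<in> subgons N T. Min Q = i}"
      using eq subgon_Min_in by (auto simp: A_def xs)
    then show ?thesis unfolding opens_def using xs(2) by (simp add: distinct_length_filter)
  qed
  ultimately have 2: "concat (map (\<lambda>Q. emit m (card {j. j < i \<and> Q \<in> set (subgons_at N T j)}))
      (filter (\<lambda>Q. \<not> A Q) xs)) = replicate (opens N T i) U"
    by (simp only: concat_map_if_single)
  have "concat (map f xs) = concat (map f (filter A xs)) @ concat (map f (filter (\<lambda>Q. \<not> A Q) xs))"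
    for f :: "nat set \<Rightarrow> letter list"
    using split by (metis concat_append map_append)
  then show ?thesis using 1 2 by (simp add: xs_def)
qed

lemma brow_eq:
  "brow N m T = concat (map (\<lambda>i. replicate (passes N T i) R @ replicate (opens N T i) U) [0..<N])"
proof -
  have "brow N m T = concat (map (\<lambda>i. concat (map (\<lambda>Q. emit m (card {j. j < i \<and> Q \<in> set (subgons_at N T j)}))
      (subgons_at N T i))) [0..<N])"
    unfolding brow_eq_emits visits_def by (intro emits_concat subgons_at(2))
  also have "\<dots> = concat (map (\<lambda>i. replicate (passes N T i) R @ replicate (opens N T i) U) [0..<N])"
    by (intro arg_cong[where f = concat] map_cong refl vertex_word) simp
  finally show ?thesis .
qed

end

subsection \<open>The browse word of the rotated angulation\<close>

lemma card_fiber: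
  assumes "bij_betw f F B"
  shows "card {Q \<in> F. f Q = v} = (if v \<in> B then 1 else 0)"
proof (cases "v \<in> B")
  case True
  then obtain Q where Q: "Q \<in> F" "f Q = v" using assms unfolding bij_betw_def by blast
  then have "{Q \<in> F. f Q = v} = {Q}" using assms by (auto simp: bij_betw_def inj_on_def)
  then show ?thesis using True by (simp only: is_singletonI card_1_singleton_iff) simp
next
  case False
  then have "{Q \<in> F. f Q = v} = {}" using bij_betwE[OF assms] by blast
  then show ?thesis using False by (simp only: card.empty if_False)
qed

context angulation
begin

section \<open>Extreme vertices and counts under rotation\<close>

lemma rot_Max_Min:
  assumes Q: "Q \<in> subgons N T" and 0: "0 \<notin> Q"
  shows "Min (rot N ` Q) = Min Q - 1" "Max (rot N ` Q) = Max Q - 1"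
proof -
  have "rot N ` Q = (\<lambda>i. i - 1) ` Q"
    using 0 subgon_less[OF Q] by (intro image_cong) (auto simp: rot_eq)
  moreover have "mono (\<lambda>i::nat. i - 1)" by (simp add: monoI)
  ultimately show "Min (rot N ` Q) = Min Q - 1" "Max (rot N ` Q) = Max Q - 1"
    using mono_Min_commute[of "\<lambda>i::nat. i - 1" Q] mono_Max_commute[of "\<lambda>i::nat. i - 1" Q]
      subgon_finite[OF Q] subgon_nonempty[OF Q] by simp_all
qed

text \<open>Vertex 0 becomes the greatest label and all others drop by one, so the second vertex
  becomes the minimum.\<close>

lemma rot_Max_Min_fan:
  assumes "Q \<in> fan"
  shows "Min (rot N ` Q) = sec Q - 1" "Max (rot N ` Q) = N - 1"
proof -
  have Q: "Q \<in> subgons N T" "0 \<in> Q" using assms by (auto simp: fan_def)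
  have fin: "finite (rot N ` Q)" using subgon_finite[OF Q(1)] by simp
  have less: "z < N" if "z \<in> rot N ` Q" for z
    using that subgon_less[OF Q(1)] rot_less by auto
  have "N - 1 \<in> rot N ` Q" using Q(2) N by (force simp: rot_eq)
  then show "Max (rot N ` Q) = N - 1" using fin less by (intro Max_eqI) fastforce+
  have secN: "sec Q < N" using subgon_less[OF Q(1) fan_sec(1)[OF assms]] .
  then have "sec Q - 1 \<in> rot N ` Q"
    using fan_sec(1,2)[OF assms] by (intro image_eqI[of _ _ "sec Q"]) (auto simp: rot_eq)
  moreover have "sec Q - 1 \<le> rot N z" if "z \<in> Q" for z
    using fan_sec(3)[OF assms that] subgon_less[OF Q(1) that] secN by (auto simp: rot_eq)
  ultimately show "Min (rot N ` Q) = sec Q - 1" using fin by (intro Min_eqI) auto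
qed

lemma card_subgons_sigma:
  "card {Q \<in> subgons N (sigma N T). P Q} = card {Q \<in> subgons N T. P (rot N ` Q)}"
proof -
  have "{Q \<in> subgons N (sigma N T). P Q} = (\<lambda>Q. rot N ` Q) ` {Q \<in> subgons N T. P (rot N ` Q)}"
    using subgons_sigma[OF N, of T] diagonal by auto
  moreover have "inj_on (\<lambda>Q. rot N ` Q) {Q \<in> subgons N T. P (rot N ` Q)}"
  proof (rule inj_onI)
    fix Q Q' assume "Q \<in> {Q \<in> subgons N T. P (rot N ` Q)}" "Q' \<in> {Q \<in> subgons N T. P (rot N ` Q)}"
      "rot N ` Q = rot N ` Q'"
    then show "Q = Q'" using rot_image_inj[of Q N Q'] subgons_subset[of _ N T] by blast
  qed
  ultimately show ?thesis by (simp add: card_image)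
qed

lemma card_subgons_split:
  "card {Q \<in> subgons N T. P Q} = card {Q \<in> subgons N T. 0 \<notin> Q \<and> P Q} + card {Q \<in> fan. P Q}"
proof -
  have "{Q \<in> subgons N T. P Q} = {Q \<in> subgons N T. 0 \<notin> Q \<and> P Q} \<union> {Q \<in> fan. P Q}"
    by (auto simp: fan_def)
  moreover have "{Q \<in> subgons N T. 0 \<notin> Q \<and> P Q} \<inter> {Q \<in> fan. P Q} = {}"
    by (auto simp: fan_def)
  ultimately show ?thesis
    using subgons_finite finite_fan by (simp add: card_Un_disjoint)
qed

lemma Suc_in_iff_in_rot:
  assumes "Q \<in> subgons N T" "Suc i < N"
  shows "i \<in> rot N ` Q \<longleftrightarrow> Suc i \<in> Q"
proof -
  have "rot N (Suc i) = i" using assms by (simp add: rot_eq)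
  then show ?thesis
    using inj_on_image_mem_iff[OF inj_on_rot, of "Suc i" N Q] assms subgons_subset[of Q N T] by simp
qed

text \<open>Away from 0 the minima merely shift. A subgon of the fan now opens at its former
  \<open>sec\<close>, and each neighbour of 0 other than \<open>N - 1\<close> is the
  \<open>sec\<close> of exactly one.\<close>

lemma opens_sigma:
  assumes "Suc i < N"
  shows "opens N (sigma N T) i = opens N T (Suc i) + (if Suc i \<in> nbrs - {N - 1} then 1 else 0)"
proof -
  have "opens N (sigma N T) i = card {Q \<in> subgons N T. 0 \<notin> Q \<and> Min (rot N ` Q) = i} +
      card {Q \<in> fan. Min (rot N ` Q) = i}"
    unfolding opens_def card_subgons_sigma by (rule card_subgons_split)
  also have "{Q \<in> subgons N T. 0 \<notin> Q \<and> Min (rot N ` Q) = i} = {Q \<in> subgons N T. Min Q = Suc i}"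
  proof (rule Collect_cong, rule conj_cong[OF refl])
    fix Q assume Q: "Q \<in> subgons N T"
    show "(0 \<notin> Q \<and> Min (rot N ` Q) = i) = (Min Q = Suc i)"
    proof (cases "0 \<in> Q")
      case True
      then have "Min Q = 0" using Q fan_Min by (simp add: fan_def)
      then show ?thesis using True by simp
    next
      case False
      then have "Min Q \<noteq> 0" using subgon_Min_in[OF Q] by metis
      then show ?thesis using False rot_Max_Min[OF Q False] by auto
    qed
  qed
  also have "{Q \<in> fan. Min (rot N ` Q) = i} = {Q \<in> fan. sec Q = Suc i}"
    using rot_Max_Min_fan fan_sec(2) by (intro Collect_cong conj_cong[OF refl]) fastforce
  finally show ?thesis
    by (simp only: opens_def card_fiber[OF bij_betw_fan_sec])
qed

text \<open>At \<open>Suc i\<close>, the subgon with \<open>sec Q = Suc i\<close> turns from a pass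
  into an opening, the one with \<open>Max Q = Suc i\<close> from a closing into a pass. Corrections
  on both sides avoid subtraction of naturals.\<close>

lemma passes_sigma:
  assumes "Suc i < N"
  shows "passes N (sigma N T) i + (if Suc i \<in> nbrs - {N - 1} then 1 else 0) =
    passes N T (Suc i) + (if Suc i \<in> nbrs - {1} then 1 else 0)"
proof -
  let ?v = "Suc i"
  \<comment> \<open>\<open>c\<close> and \<open>d\<close> count the subgons, in the fan and outside
    it, that pass both before and after rotation.\<close>
  define c where "c = card {Q \<in> fan. ?v \<in> Q \<and> sec Q < ?v \<and> ?v < Max Q}"
  define d where "d = card {Q \<in> subgons N T. 0 \<notin> Q \<and> (?v \<in> Q \<and> Min Q < ?v \<and> ?v < Max Q)}"
  have fin: "finite {Q \<in> fan. P Q}" for P using finite_fan by simp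
  have le: "z \<le> Max Q" if "Q \<in> fan" "z \<in> Q" for Q z
    using that subgon_le_Max by (simp add: fan_def)
  have Max: "Max Q \<in> Q" if "Q \<in> fan" for Q
    using that subgon_Max_in by (simp add: fan_def)
  have "passes N (sigma N T) i =
      card {Q \<in> subgons N T. 0 \<notin> Q \<and> (i \<in> rot N ` Q \<and> Min (rot N ` Q) < i \<and> i < Max (rot N ` Q))} +
      card {Q \<in> fan. i \<in> rot N ` Q \<and> Min (rot N ` Q) < i \<and> i < Max (rot N ` Q)}"
    unfolding passes_def card_subgons_sigma by (rule card_subgons_split)
  also have "{Q \<in> subgons N T. 0 \<notin> Q \<and> (i \<in> rot N ` Q \<and> Min (rot N ` Q) < i \<and> i < Max (rot N ` Q))} =
      {Q \<in> subgons N T. 0 \<notin> Q \<and> (?v \<in> Q \<and> Min Q < ?v \<and> ?v < Max Q)}"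
  proof (intro Collect_cong conj_cong refl)
    fix Q assume Q: "Q \<in> subgons N T" "0 \<notin> Q"
    then have "Min Q \<noteq> 0" using subgon_Min_in[OF Q(1)] by metis
    then show "(i \<in> rot N ` Q) = (?v \<in> Q)" "(Min (rot N ` Q) < i) = (Min Q < ?v)"
      "(i < Max (rot N ` Q)) = (?v < Max Q)"
      unfolding rot_Max_Min[OF Q] using Suc_in_iff_in_rot[OF Q(1) assms] by linarith+
  qed
  also have "{Q \<in> fan. i \<in> rot N ` Q \<and> Min (rot N ` Q) < i \<and> i < Max (rot N ` Q)} =
      {Q \<in> fan. ?v \<in> Q \<and> sec Q < ?v}"
  proof (rule Collect_cong, rule conj_cong[OF refl])
    fix Q assume Q: "Q \<in> fan"
    have "(i \<in> rot N ` Q) = (?v \<in> Q)" using Q Suc_in_iff_in_rot assms by (simp add: fan_def)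
    then show "(i \<in> rot N ` Q \<and> Min (rot N ` Q) < i \<and> i < Max (rot N ` Q)) = (?v \<in> Q \<and> sec Q < ?v)"
      unfolding rot_Max_Min_fan[OF Q] using fan_sec(2)[OF Q] assms by auto
  qed
  also have "{Q \<in> fan. ?v \<in> Q \<and> sec Q < ?v} =
      {Q \<in> fan. ?v \<in> Q \<and> sec Q < ?v \<and> ?v < Max Q} \<union> {Q \<in> fan. Max Q = ?v}" (is "_ = ?X \<union> ?Y")
  proof (intro set_eqI iffI)
    fix Q assume "Q \<in> {Q \<in> fan. ?v \<in> Q \<and> sec Q < ?v}"
    then show "Q \<in> ?X \<union> ?Y" using le[of Q ?v] by auto
  next
    fix Q assume "Q \<in> ?X \<union> ?Y"
    then show "Q \<in> {Q \<in> fan. ?v \<in> Q \<and> sec Q < ?v}" using Max[of Q] fan_sec(4)[of Q] by auto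
  qed
  also have "card (?X \<union> ?Y) = c + (if ?v \<in> nbrs - {1} then 1 else 0)"
    unfolding c_def card_fiber[OF bij_betw_fan_Max, symmetric]
    by (rule card_Un_disjoint) (auto simp: fin)
  finally have 1: "passes N (sigma N T) i = d + (c + (if ?v \<in> nbrs - {1} then 1 else 0))"
    by (simp only: d_def)
  have "passes N T ?v = d + card {Q \<in> fan. ?v \<in> Q \<and> Min Q < ?v \<and> ?v < Max Q}"
    unfolding passes_def d_def by (rule card_subgons_split)
  also have "{Q \<in> fan. ?v \<in> Q \<and> Min Q < ?v \<and> ?v < Max Q} =
      {Q \<in> fan. ?v \<in> Q \<and> sec Q < ?v \<and> ?v < Max Q} \<union> {Q \<in> fan. sec Q = ?v}" (is "?Z = ?X \<union> ?Y")
  proof (intro set_eqI iffI)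
    fix Q assume "Q \<in> ?Z"
    then show "Q \<in> ?X \<union> ?Y" using fan_sec(3)[of Q ?v] by auto
  next
    fix Q assume "Q \<in> ?X \<union> ?Y"
    then show "Q \<in> ?Z" using fan_sec(1,4)[of Q] fan_Min[of Q] by auto
  qed
  also have "card (?X \<union> ?Y) = c + (if ?v \<in> nbrs - {N - 1} then 1 else 0)"
    unfolding c_def card_fiber[OF bij_betw_fan_sec, symmetric]
    by (rule card_Un_disjoint) (auto simp: fin)
  finally show ?thesis using 1 by simp
qed

section \<open>The words at the extreme vertices\<close>

lemma passes_0: "passes N T 0 = 0"
  by (simp add: passes_def)

lemma passes_last: "passes N T (N - 1) = 0"
proof -
  have "\<not> N - 1 < Max Q" if "Q \<in> subgons N T" for Q
    using subgon_less[OF that subgon_Max_in[OF that]] by linarith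
  then have "{Q \<in> subgons N T. N - 1 \<in> Q \<and> Min Q < N - 1 \<and> N - 1 < Max Q} = {}" by blast
  then show ?thesis unfolding passes_def by (simp only: card.empty)
qed

lemma opens_last: "opens N T (N - 1) = 0"
proof -
  have "Min Q \<noteq> N - 1" if "Q \<in> subgons N T" for Q
    using subgon_less[OF that subgon_Max_in[OF that]] subgon_Min_less_Max[OF that] by linarith
  then have "{Q \<in> subgons N T. Min Q = N - 1} = {}" by blast
  then show ?thesis unfolding opens_def by (simp only: card.empty)
qed

lemma opens_0: "opens N T 0 = card fan"
proof -
  have "Min Q = 0 \<longleftrightarrow> 0 \<in> Q" if "Q \<in> subgons N T" for Q
    using subgon_Min_in[OF that] fan_Min[of Q] that by (auto simp: fan_def)
  then have "{Q \<in> subgons N T. Min Q = 0} = fan" by (auto simp: fan_def)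
  then show ?thesis by (simp add: opens_def)
qed

lemma angulation_sigma: "angulation N m (sigma N T)"
  using N is_angulation_sigma[OF N angulation] by unfold_locales

text \<open>After rotation this is vertex 0, which is never passed; comparing by
  \<open>passes_sigma\<close> leaves the subgon with \<open>sec Q = 1\<close>.\<close>

lemma passes_1: "passes N T 1 = 1"
proof -
  have "passes N (sigma N T) 0 = 0" using angulation.passes_0[OF angulation_sigma] .
  moreover have "Suc 0 \<noteq> N - Suc 0" using N by simp
  ultimately show ?thesis using passes_sigma[of 0] nbrs_ends N by simp
qed

text \<open>The right-hand side keeps the old labels, \<open>i\<close> having become
  \<open>i - 1\<close>. The first \<open>U\<close> opens the subgon at neighbour 1; the last
  \<open>R\<close> belongs to the subgon with maximum \<open>N - 1\<close>, which now closes at the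
  old vertex 0.\<close>

lemma brow_sigma_eq:
  "brow N m (sigma N T) = U # replicate (opens N T 1) U @
     concat (map (\<lambda>i. replicate (passes N T i) R @
       replicate ((if i \<in> nbrs then 1 else 0) + opens N T i) U) [2..<N - 1]) @ [R]"
proof -
  interpret s: angulation N m "sigma N T" by (rule angulation_sigma)
  define W where "W i = replicate (passes N (sigma N T) i) R @ replicate (opens N (sigma N T) i) U" for i
  have W1: "W 0 = U # replicate (opens N T 1) U"
  proof -
    have "Suc 0 \<noteq> N - Suc 0" using N by simp
    then show ?thesis using opens_sigma[of 0] nbrs_ends N by (simp add: W_def s.passes_0)
  qed
  have "passes N (sigma N T) (N - 2) = 1" "opens N (sigma N T) (N - 2) = 0"
  proof -
    have "Suc (N - 2) = N - 1" "Suc (N - 2) < N" "N - 1 \<noteq> 1" using N by auto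
    then show "passes N (sigma N T) (N - 2) = 1" "opens N (sigma N T) (N - 2) = 0"
      using passes_sigma[of "N - 2"] opens_sigma[of "N - 2"] nbrs_ends passes_last opens_last
      by simp_all
  qed
  then have W2: "W (N - 2) = [R]" by (simp add: W_def)
  have W3: "W (N - 1) = []" by (simp only: W_def s.passes_last s.opens_last) simp
  \<comment> \<open>Strictly between 1 and \<open>N - 1\<close> the two corrections in
    \<open>passes_sigma\<close> agree, so the number of \<open>R\<close> is unchanged.\<close>
  have W: "W (i - 1) = replicate (passes N T i) R @
      replicate ((if i \<in> nbrs then 1 else 0) + opens N T i) U" if "i \<in> set [2..<N - 1]" for i
  proof -
    have i: "Suc (i - 1) = i" "i \<noteq> 1" "i \<noteq> N - 1" "Suc (i - 1) < N" using that by auto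
    then show ?thesis
      unfolding W_def using passes_sigma[of "i - 1"] opens_sigma[of "i - 1"] by simp
  qed
  have shift: "map W [1..<N - 2] = map (\<lambda>i. W (i - 1)) [2..<N - 1]"
  proof -
    have "Suc 1 = 2" "Suc (N - 2) = N - 1" using N by auto
    then have "[2..<N - 1] = map Suc [1..<N - 2]" by (simp only: map_Suc_upt)
    then show ?thesis by (simp add: comp_def)
  qed
  have "[0..<N] = 0 # [1..<N - 2] @ [N - 2, N - 1]"
  proof -
    have "[0..<Suc (Suc M)] = [0..<M] @ [M, Suc M]" for M by simp
    moreover have "Suc (N - 2) = N - 1" "Suc (N - 1) = N" using N by auto
    ultimately have "[0..<N] = [0..<N - 2] @ [N - 2, N - 1]" by metis
    also have "[0..<N - 2] = 0 # [1..<N - 2]" using N by (subst upt_conv_Cons) auto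
    finally show ?thesis by simp
  qed
  then have "concat (map W [0..<N]) = W 0 @ concat (map W [1..<N - 2]) @ W (N - 2) @ W (N - 1)"
    by simp
  also have "map W [1..<N - 2] = map (\<lambda>i. replicate (passes N T i) R @
      replicate ((if i \<in> nbrs then 1 else 0) + opens N T i) U) [2..<N - 1]"
    unfolding shift by (rule map_cong[OF refl W])
  finally show ?thesis
    unfolding s.brow_eq W_def[abs_def, symmetric] W1 W2 W3 by simp
qed

end

subsection \<open>Rotation of a word of blocks\<close>

definition block :: "(nat \<Rightarrow> nat) \<Rightarrow> (nat \<Rightarrow> nat) \<Rightarrow> nat \<Rightarrow> letter list" where
  "block r u i = replicate (r i) R @ replicate (u i) U"

definition blocks :: "(nat \<Rightarrow> nat) \<Rightarrow> (nat \<Rightarrow> nat) \<Rightarrow> nat \<Rightarrow> letter list" where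
  "blocks r u n = concat (map (block r u) [0..<n])"

definition height :: "nat \<Rightarrow> letter list \<Rightarrow> int" where
  "height m w = sum_list (map (hgt m) w)"

lemma H_eq_height: "H m D p = height m (take p D)"
  by (simp add: H_def height_def)

lemma height_append: "height m (v @ w) = height m v + height m w"
  by (simp add: height_def)

lemma height_replicate:
  "height m (replicate j R) = - int j" "height m (replicate j U) = int m * int j"
  by (simp_all add: height_def hgt_def sum_list_replicate)

lemma blocks_Suc: "blocks r u (Suc n) = blocks r u n @ block r u n"
  by (simp add: blocks_def)

lemma blocks_split: "i \<le> n \<Longrightarrow> blocks r u n = blocks r u i @ concat (map (block r u) [i..<n])"
proof -
  assume "i \<le> n"
  then have "[0..<n] = [0..<i] @ [i..<n]" using upt_add_eq_append[of 0 i "n - i"] by simp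
  then show ?thesis by (simp add: blocks_def)
qed

lemma length_block: "length (block r u i) = r i + u i"
  by (simp add: block_def)

lemma height_blocks:
  "height m (blocks r u n) = (\<Sum>j<n. int m * int (u j) - int (r j))"
proof (induction n)
  case 0
  then show ?case by (simp add: blocks_def height_def)
next
  case (Suc n)
  then show ?case by (simp add: blocks_Suc block_def height_append height_replicate)
qed

text \<open>A block descends before it ascends, so its lowest point is the end of its
  \<open>R\<close>-part. The condition \<open>u 0 < p\<close> skips the initial run of
  \<open>U\<close>, where the bound may fail.\<close>

lemma height_blocks_ge:
  assumes "\<And>i. 1 \<le> i \<Longrightarrow> i < n \<Longrightarrow> B \<le> height m (blocks r u i) - int (r i)"
    and "r 0 = 0" "u 0 < p" "p \<le> length (blocks r u n)"
  shows "B \<le> height m (take p (blocks r u n))"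
  using assms
proof (induction n)
  case 0
  then show ?case by (simp add: blocks_def)
next
  case (Suc n)
  show ?case
  proof (cases "p \<le> length (blocks r u n)")
    case True
    then have "B \<le> height m (take p (blocks r u n))"
      using Suc.prems by (intro Suc.IH) auto
    then show ?thesis using True by (simp add: blocks_Suc)
  next
    case False
    define q where "q = p - length (blocks r u n)"
    have p: "p = length (blocks r u n) + q" using False by (simp add: q_def)
    have "n \<noteq> 0"
    proof
      assume "n = 0"
      then have "length (blocks r u (Suc n)) = u 0"
        using Suc.prems(2) by (simp add: blocks_def block_def)
      then show False using Suc.prems by simp
    qed
    then have B: "B \<le> height m (blocks r u n) - int (r n)"
      using Suc.prems(1)[of n] by simp
    have "- int (r n) \<le> height m (take q (block r u n))"
      by (auto simp: block_def height_append height_replicate min_def)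
    then show ?thesis using B by (simp add: blocks_Suc p height_append)
  qed
qed

text \<open>The earlier blocks stay at or above \<open>B\<close>, and block \<open>a\<close>
  descends in unit steps to exactly \<open>B - 1\<close>, so only its last \<open>R\<close>
  undercuts \<open>B\<close>.\<close>

lemma Least_height_blocks:
  assumes ge: "\<And>i. 1 \<le> i \<Longrightarrow> i < a \<Longrightarrow> B \<le> height m (blocks r u i) - int (r i)"
    and B: "height m (blocks r u a) - int (r a) = B - 1"
    and r: "r 0 = 0" "1 \<le> r a" and a: "1 \<le> a" "a < n"
  shows "(LEAST p. u 0 < p \<and> H m (blocks r u n) p < B) = length (blocks r u a) + r a"
proof (rule Least_equality)
  obtain w where w: "blocks r u n = blocks r u a @ replicate (r a) R @ w"
    using blocks_split[of a n r u] a by (auto simp: upt_conv_Cons block_def)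
  have "u 0 \<le> length (blocks r u a)"
    using blocks_split[of 1 a r u] a r by (simp add: blocks_def block_def)
  moreover have "H m (blocks r u n) (length (blocks r u a) + r a) = B - 1"
    using B by (simp add: w H_eq_height height_append height_replicate)
  ultimately show "u 0 < length (blocks r u a) + r a \<and>
      H m (blocks r u n) (length (blocks r u a) + r a) < B"
    using r by simp
  fix p assume p: "u 0 < p \<and> H m (blocks r u n) p < B"
  show "length (blocks r u a) + r a \<le> p"
  proof (rule ccontr)
    assume "\<not> length (blocks r u a) + r a \<le> p"
    show False
    proof (cases "p \<le> length (blocks r u a)")
      case True
      then have "B \<le> height m (take p (blocks r u a))"
        using ge r p by (intro height_blocks_ge) auto
      then show False using p True by (simp add: w H_eq_height)
    next
      case False
      define q where "q = p - length (blocks r u a)"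
      have "p = length (blocks r u a) + q" "q < r a"
        using False \<open>\<not> length (blocks r u a) + r a \<le> p\<close> by (auto simp: q_def)
      then have "H m (blocks r u n) p = height m (blocks r u a) - int q"
        by (simp add: w H_eq_height height_append height_replicate)
      then show False using p B \<open>q < r a\<close> by linarith
    qed
  qed
qed

text \<open>The insertion of \<open>rot_tilde\<close> on a factor \<open>w\<close> preceded by
  \<open>off\<close> letters; \<open>c\<close> is indexed by positions in the whole word, counted
  from 1.\<close>

definition insert_U :: "(nat \<Rightarrow> nat) \<Rightarrow> nat \<Rightarrow> letter list \<Rightarrow> letter list" where
  "insert_U c off w = concat (map (\<lambda>j. w ! j # replicate (c (off + Suc j)) U) [0..<length w])"

lemma insert_U_Nil: "insert_U c off [] = []"
  by (simp add: insert_U_def)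

lemma insert_U_snoc:
  "insert_U c off (w @ [x]) = insert_U c off w @ x # replicate (c (off + Suc (length w))) U"
proof -
  define F where "F j = (w @ [x]) ! j # replicate (c (off + Suc j)) U" for j
  have "insert_U c off (w @ [x]) = concat (map F [0..<length w]) @ F (length w)"
    by (simp add: insert_U_def F_def[abs_def])
  also have "map F [0..<length w] = map (\<lambda>j. w ! j # replicate (c (off + Suc j)) U) [0..<length w]"
    by (rule map_cong) (auto simp: F_def nth_append)
  finally show ?thesis by (simp add: insert_U_def F_def)
qed

lemma insert_U_append:
  "insert_U c off (v @ w) = insert_U c off v @ insert_U c (off + length v) w"
proof (induction w rule: rev_induct)
  case Nil
  then show ?case by (simp add: insert_U_Nil)
next
  case (snoc x w)
  then show ?case
    using insert_U_snoc[of c off "v @ w" x] insert_U_snoc[of c "off + length v" w x]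
    by (simp add: add.assoc)
qed

lemma insert_U_id:
  "(\<And>j. 1 \<le> j \<Longrightarrow> j \<le> length w \<Longrightarrow> c (off + j) = 0) \<Longrightarrow> insert_U c off w = w"
proof (induction w rule: rev_induct)
  case (snoc x w)
  then show ?case using snoc.prems[of "Suc (length w)"] by (simp add: insert_U_snoc)
qed (simp add: insert_U_Nil)

text \<open>A \<open>U\<close> inserted after the last \<open>R\<close> merges with the following
  run of \<open>U\<close>.\<close>

lemma insert_U_block:
  assumes c: "\<And>j. 1 \<le> j \<Longrightarrow> j \<le> r i + u i \<Longrightarrow> c (off + j) = (if P \<and> j = r i then 1 else 0)"
    and r: "P \<Longrightarrow> 1 \<le> r i"
  shows "insert_U c off (block r u i) = replicate (r i) R @ replicate ((if P then 1 else 0) + u i) U"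
proof (cases P)
  case False
  then show ?thesis using c by (subst insert_U_id) (auto simp: block_def)
next
  case True
  then obtain q where q: "r i = Suc q" using r by (cases "r i") auto
  have b: "block r u i = (replicate q R @ [R]) @ replicate (u i) U"
    by (simp add: block_def q replicate_append_same)
  have "insert_U c off (replicate q R) = replicate q R"
    using c q by (intro insert_U_id) auto
  moreover have "insert_U c (off + q) [R] = [R, U]"
    using insert_U_snoc[of c "off + q" "[]" R] c[of "Suc q"] True q by (simp add: insert_U_Nil)
  moreover have "insert_U c (off + Suc q) (replicate (u i) U) = replicate (u i) U"
  proof (rule insert_U_id)
    fix j assume "1 \<le> j" "j \<le> length (replicate (u i) U)"
    then show "c (off + Suc q + j) = 0" using c[of "Suc q + j"] q by (simp add: add.assoc)
  qed
  ultimately show ?thesis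
    unfolding b insert_U_append using True by (simp add: q replicate_app_Cons_same)
qed

lemma insert_U_blocks:
  "insert_U c 0 (blocks r u n) =
    concat (map (\<lambda>i. insert_U c (length (blocks r u i)) (block r u i)) [0..<n])"
  by (induction n) (simp_all add: blocks_Suc insert_U_append, simp add: blocks_def insert_U_Nil)

lemma takeWhile_replicate_U: "takeWhile (\<lambda>x. x = U) (replicate k U @ R # w) = replicate k U"
  by (induction k) auto

text \<open>Here \<open>A\<close> is the set of blocks receiving an inserted \<open>U\<close>, and \<open>c a\<close> is the index
  whose level \<open>m * c a\<close> is first undercut at the end of the \<open>R\<close>-part of block \<open>a\<close>.\<close>

lemma rot_tilde_blocks:
  fixes r u :: "nat \<Rightarrow> nat"
  assumes r: "r 0 = 0" "r 1 = 1" and n: "2 \<le> n"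
    and A: "A \<subseteq> {2..<n}" "\<And>a. a \<in> A \<Longrightarrow> 1 \<le> r a"
    and c: "bij_betw c A {1..u 0 - 1}"
    and ge: "\<And>a i. a \<in> A \<Longrightarrow> 1 \<le> i \<Longrightarrow> i < a \<Longrightarrow>
      int m * int (c a) \<le> height m (blocks r u i) - int (r i)"
    and below: "\<And>a. a \<in> A \<Longrightarrow> height m (blocks r u a) - int (r a) = int m * int (c a) - 1"
  shows "rot_tilde m (blocks r u n) = U # replicate (u 1) U @
    concat (map (\<lambda>i. replicate (r i) R @ replicate ((if i \<in> A then 1 else 0) + u i) U) [2..<n]) @ [R]"
proof -
  define D where "D = blocks r u n"
  define L where "L a = length (blocks r u a) + r a" for a
  define p' where "p' i = (LEAST p. u 0 < p \<and> H m D p < int m * int i)" for i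
  define d where "d j = card {i \<in> {1..u 0 - 1}. p' i = j}" for j
  have n2: "[0..<n] = 0 # 1 # [2..<n]"
    using n by (simp add: upt_conv_Cons numeral_2_eq_2)
  have D: "D = replicate (u 0) U @ R # replicate (u 1) U @ concat (map (block r u) [2..<n])"
    using r by (simp add: D_def blocks_def n2 block_def)
  then have k: "length (takeWhile (\<lambda>x. x = U) D) = u 0" by (simp add: takeWhile_replicate_U)
  \<comment> \<open>\<open>rot_tilde\<close> counts positions from 1, \<open>insert_U\<close>
    indexes letters from 0.\<close>
  have "map (\<lambda>j. [D ! (j - 1)] @ replicate (d j) U) [1..<length D + 1] =
      map (\<lambda>j. D ! j # replicate (d (0 + Suc j)) U) [0..<length D]"
    unfolding One_nat_def add_Suc_right add_0_right map_Suc_upt[symmetric] by simp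
  then have rt: "rot_tilde m D = [U] @ drop (u 0 + 1) (insert_U d 0 D) @ [R]"
    unfolding rot_tilde_def Let_def k insert_U_def p'_def[symmetric] d_def[symmetric] by simp
  have p'_c: "p' (c a) = L a" if a: "a \<in> A" for a
    unfolding p'_def D_def L_def
    using ge[OF a] below[OF a] r(1) A(2)[OF a] A(1) a by (intro Least_height_blocks) auto
  \<comment> \<open>The levels \<open>i\<close> are the values \<open>c a\<close>, so the insertions
    at position \<open>j\<close> can be counted by blocks.\<close>
  have d_card: "d j = card {a \<in> A. L a = j}" for j
  proof -
    have "{i \<in> {1..u 0 - 1}. p' i = j} = c ` {a \<in> A. L a = j}"
      unfolding bij_betw_imp_surj_on[OF c, symmetric] using p'_c by auto
    moreover have "inj_on c {a \<in> A. L a = j}"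
      by (rule inj_on_subset[OF bij_betw_imp_inj_on[OF c]]) auto
    ultimately show ?thesis by (simp add: d_def card_image)
  qed
  have mono: "length (blocks r u i) \<le> length (blocks r u j)" if "i \<le> j" for i j
    using blocks_split[OF that, of r u] by simp
  \<comment> \<open>The position \<open>L a\<close> falls inside block \<open>a\<close> itself,
    since that block starts with at least one \<open>R\<close>.\<close>
  have L_in: "a = i \<and> j = r i" if "a \<in> A" "L a = length (blocks r u i) + j" "1 \<le> j" "j \<le> r i + u i" for a i j
  proof -
    have "\<not> a < i"
    proof
      assume "a < i"
      then have "L a \<le> length (blocks r u i)"
        using mono[of "Suc a" i] by (simp add: blocks_Suc length_block L_def)
      then show False using that by simp
    qed
    moreover have "\<not> i < a"
    proof
      assume "i < a"
      then have "length (blocks r u i) + j < L a"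
        using mono[of "Suc i" a] that(4) A(2)[OF that(1)] by (simp add: blocks_Suc length_block L_def)
      then show False using that by simp
    qed
    ultimately have "a = i" by simp
    then show ?thesis using that(2) by (simp add: L_def)
  qed
  have d: "d (length (blocks r u i) + j) = (if i \<in> A \<and> j = r i then 1 else 0)"
    if "1 \<le> j" "j \<le> r i + u i" for i j
  proof -
    have "{a \<in> A. L a = length (blocks r u i) + j} = (if i \<in> A \<and> j = r i then {i} else {})"
      using L_in[OF _ _ that] by (auto simp: L_def)
    then show ?thesis unfolding d_card by simp
  qed
  have block: "insert_U d (length (blocks r u i)) (block r u i) =
      replicate (r i) R @ replicate ((if i \<in> A then 1 else 0) + u i) U" for i
    using d A(2) by (intro insert_U_block) auto
  \<comment> \<open>Blocks 0 and 1 receive no insertion, so \<open>drop (u 0 + 1)\<close> removes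
    exactly the initial run of \<open>U\<close> and the single \<open>R\<close> after it.\<close>
  have notA: "0 \<notin> A" "1 \<notin> A" using A(1) by auto
  have "insert_U d 0 D = replicate (u 0) U @ R # replicate (u 1) U @
    concat (map (\<lambda>i. replicate (r i) R @ replicate ((if i \<in> A then 1 else 0) + u i) U) [2..<n])"
    unfolding D_def insert_U_blocks block n2 using r notA by simp
  then show ?thesis unfolding D_def[symmetric] rt by simp
qed

subsection \<open>Heights\<close>

lemma card_eq_sum_indicator: "finite A \<Longrightarrow> card {x \<in> A. P x} = (\<Sum>x\<in>A. if P x then 1 else 0)"
  by (simp add: sum.If_cases Int_def)

context angulation
begin

text \<open>The contribution of \<open>Q\<close> to the height of \<open>brow N m T\<close> after the \<open>R\<close>-steps of vertex \<open>i\<close>.\<close>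

definition contrib :: "nat \<Rightarrow> nat set \<Rightarrow> int" where
  "contrib i Q = (if Min Q < i then int m else 0) -
     int (card {v. v \<le> i \<and> v \<in> Q \<and> Min Q < v \<and> v < Max Q})"

text \<open>Double counting: every letter is charged to the subgon that emits it, and the sums over
  vertices and subgons are exchanged.\<close>

lemma height_eq_sum_contrib:
  "height m (blocks (passes N T) (opens N T) i) - int (passes N T i) = (\<Sum>Q\<in>subgons N T. contrib i Q)"
proof -
  have "(\<Sum>j<i. opens N T j) = (\<Sum>Q\<in>subgons N T. \<Sum>j<i. if Min Q = j then 1 else 0)"
    unfolding opens_def card_eq_sum_indicator[OF subgons_finite] by (rule sum.swap)
  also have "\<dots> = (\<Sum>Q\<in>subgons N T. if Min Q < i then 1 else 0)"
    by (intro sum.cong refl) simp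
  finally have o: "(\<Sum>j<i. opens N T j) = (\<Sum>Q\<in>subgons N T. if Min Q < i then 1 else 0)" .
  have "(\<Sum>j\<le>i. passes N T j) =
      (\<Sum>Q\<in>subgons N T. \<Sum>j\<le>i. if j \<in> Q \<and> Min Q < j \<and> j < Max Q then 1 else 0)"
    unfolding passes_def card_eq_sum_indicator[OF subgons_finite] by (rule sum.swap)
  also have "\<dots> = (\<Sum>Q\<in>subgons N T. card {v. v \<le> i \<and> v \<in> Q \<and> Min Q < v \<and> v < Max Q})"
  proof (intro sum.cong refl)
    fix Q
    show "(\<Sum>j\<le>i. if j \<in> Q \<and> Min Q < j \<and> j < Max Q then 1 else 0) =
        card {v. v \<le> i \<and> v \<in> Q \<and> Min Q < v \<and> v < Max Q}"
      using card_eq_sum_indicator[of "{..i}" "\<lambda>j. j \<in> Q \<and> Min Q < j \<and> j < Max Q"] by simp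
  qed
  finally have p: "(\<Sum>j\<le>i. passes N T j) =
      (\<Sum>Q\<in>subgons N T. card {v. v \<le> i \<and> v \<in> Q \<and> Min Q < v \<and> v < Max Q})" .
  have "height m (blocks (passes N T) (opens N T) i) - int (passes N T i) =
      int m * int (\<Sum>j<i. opens N T j) - int (\<Sum>j\<le>i. passes N T j)"
    by (simp add: height_blocks sum_subtractf sum_distrib_left lessThan_Suc_atMost[symmetric])
  also have "\<dots> = (\<Sum>Q\<in>subgons N T. contrib i Q)"
    unfolding o p contrib_def sum_subtractf of_nat_sum sum_distrib_left
    by (intro arg_cong2[where f = minus] sum.cong refl) simp
  finally show ?thesis .
qed

text \<open>Apart from its two extreme vertices a subgon has exactly \<open>m\<close>
  vertices.\<close>

lemma contrib_inner_card:
  assumes "Q \<in> subgons N T"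
  shows "card {v. v \<le> i \<and> v \<in> Q \<and> Min Q < v \<and> v < Max Q} \<le> m"
    and "Max Q \<le> i \<Longrightarrow> card {v. v \<le> i \<and> v \<in> Q \<and> Min Q < v \<and> v < Max Q} = m"
proof -
  have fin: "finite Q" using subgon_finite[OF assms] .
  have card: "card (Q - {Min Q, Max Q}) = m"
    using subgon_Min_in[OF assms] subgon_Max_in[OF assms] subgon_Min_less_Max[OF assms]
      subgon_card[OF assms] by (subst card_Diff_subset) auto
  have "{v. v \<le> i \<and> v \<in> Q \<and> Min Q < v \<and> v < Max Q} \<subseteq> Q - {Min Q, Max Q}" by auto
  then show "card {v. v \<le> i \<and> v \<in> Q \<and> Min Q < v \<and> v < Max Q} \<le> m"
    using card fin by (metis card_mono finite_Diff)
  assume i: "Max Q \<le> i"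
  have "{v. v \<le> i \<and> v \<in> Q \<and> Min Q < v \<and> v < Max Q} = Q - {Min Q, Max Q}"
    using i Min_le[OF fin] Max_ge[OF fin] by (auto simp: order.strict_iff_order intro: order.trans)
  then show "card {v. v \<le> i \<and> v \<in> Q \<and> Min Q < v \<and> v < Max Q} = m" using card by simp
qed

lemma contrib_unopened: "i \<le> Min Q \<Longrightarrow> contrib i Q = 0"
proof -
  assume "i \<le> Min Q"
  then have "{v. v \<le> i \<and> v \<in> Q \<and> Min Q < v \<and> v < Max Q} = {}" by auto
  then show ?thesis using \<open>i \<le> Min Q\<close> unfolding contrib_def by (simp only: card.empty) simp
qed

lemma contrib_nonneg: "Q \<in> subgons N T \<Longrightarrow> 0 \<le> contrib i Q"
  using contrib_inner_card(1)[of Q i] contrib_unopened[of i Q]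
  by (cases "Min Q < i") (auto simp: contrib_def)

lemma contrib_closed: "Q \<in> subgons N T \<Longrightarrow> Max Q \<le> i \<Longrightarrow> contrib i Q = 0"
  using contrib_inner_card(2)[of Q i] subgon_Min_less_Max[of Q] by (simp add: contrib_def)

text \<open>Such a subgon opened at 0, and its first \<open>R\<close> comes at
  \<open>sec Q\<close>.\<close>

lemma contrib_fan:
  assumes "Q \<in> fan" "1 \<le> i" "i \<le> sec Q"
  shows "contrib i Q = int m - (if sec Q = i then 1 else 0)"
proof -
  have "{v. v \<le> i \<and> v \<in> Q \<and> Min Q < v \<and> v < Max Q} = (if sec Q = i then {sec Q} else {})"
    (is "?X = ?Y")
  proof (intro set_eqI iffI)
    fix v assume "v \<in> ?X"
    then show "v \<in> ?Y" using fan_sec(3)[OF assms(1), of v] assms(3) by auto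
  next
    fix v assume "v \<in> ?Y"
    then show "v \<in> ?X"
      using fan_sec(1,2,4)[OF assms(1)] fan_Min[OF assms(1)] by (auto split: if_splits)
  qed
  then have "card {v. v \<le> i \<and> v \<in> Q \<and> Min Q < v \<and> v < Max Q} = (if sec Q = i then 1 else 0)"
    by simp
  then show ?thesis using assms(2) by (simp add: contrib_def fan_Min[OF assms(1)])
qed

lemma fan_obtain_sec:
  assumes "a \<in> nbrs - {N - 1}"
  obtains Q where "Q \<in> fan" "sec Q = a"
proof -
  have "a \<in> sec ` fan"
    using assms by (simp only: bij_betw_imp_surj_on[OF bij_betw_fan_sec])
  then show ?thesis using that by blast
qed

text \<open>For \<open>a\<close> the neighbour \<open>a\<^sub>j\<close> these are the
  \<open>k - j\<close> subgons from \<open>a\<close> on, so the cardinality is the index of the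
  level undercut at \<open>a\<close>.\<close>

definition later :: "nat \<Rightarrow> nat set set" where
  "later a = {Q \<in> fan. a \<le> sec Q}"

lemma later_subset: "later a \<subseteq> subgons N T" "later a \<subseteq> fan"
  by (auto simp: later_def fan_def)

text \<open>Before \<open>a\<close> the subgons in \<open>later a\<close> have emitted no
  \<open>R\<close> and contribute \<open>m\<close> each; the others contribute at least 0.\<close>

lemma height_ge_later:
  assumes "1 \<le> i" "i < a"
  shows "int m * int (card (later a)) \<le>
    height m (blocks (passes N T) (opens N T) i) - int (passes N T i)"
proof -
  have "int m * int (card (later a)) = (\<Sum>Q\<in>later a. contrib i Q)"
    using assms by (simp add: later_def contrib_fan)
  also have "\<dots> \<le> (\<Sum>Q\<in>subgons N T. contrib i Q)"
    using subgons_finite later_subset contrib_nonneg by (intro sum_mono2) auto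
  finally show ?thesis unfolding height_eq_sum_contrib .
qed

text \<open>A subgon having \<open>a\<close> strictly between its extremes lies in the fan, hence in
  \<open>later a\<close>. All others outside \<open>later a\<close> are unopened or closed and
  contribute 0. Within \<open>later a\<close> only the one with \<open>sec Q = a\<close> has emitted
  an \<open>R\<close>.\<close>

lemma height_at_nbr:
  assumes a: "a \<in> nbrs - {N - 1}"
  shows "height m (blocks (passes N T) (opens N T) a) - int (passes N T a) =
    int m * int (card (later a)) - 1"
proof -
  have a1: "1 \<le> a" using a by (auto simp: nbrs_def)
  have fin: "finite (later a)" using finite_fan by (simp add: later_def)
  have "contrib a Q = 0" if Q: "Q \<in> subgons N T - later a" for Q
  proof (cases "Min Q < a \<and> a < Max Q")
    case True
    then have "Q \<in> fan" using nbr_inside_subgon[of Q a] Q a by (simp add: fan_def)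
    then have "a \<le> sec Q" using fan_nbr_side[of Q a] a True by auto
    then show ?thesis using Q \<open>Q \<in> fan\<close> by (simp add: later_def)
  next
    case False
    then show ?thesis using contrib_unopened contrib_closed Q by (meson DiffD1 not_le)
  qed
  then have "(\<Sum>Q\<in>subgons N T. contrib a Q) = (\<Sum>Q\<in>later a. contrib a Q)"
    using subgons_finite later_subset by (intro sum.mono_neutral_right) auto
  also have "\<dots> = (\<Sum>Q\<in>later a. int m - (if sec Q = a then 1 else 0))"
    using a1 by (intro sum.cong refl contrib_fan) (auto simp: later_def)
  also have "\<dots> = int m * int (card (later a)) - int (card {Q \<in> later a. sec Q = a})"
    by (simp add: sum_subtractf sum.If_cases[OF fin] Int_def)
  also have "{Q \<in> later a. sec Q = a} = {Q \<in> fan. sec Q = a}" by (auto simp: later_def)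
  also have "card \<dots> = 1" using card_fiber[OF bij_betw_fan_sec, of a] a by simp
  finally show ?thesis unfolding height_eq_sum_contrib by simp
qed

text \<open>The cardinality decreases strictly along the neighbours, since passing \<open>a\<close>
  loses the subgon with \<open>sec Q = a\<close>. Omitting both ends leaves \<open>k - 1\<close>
  neighbours and \<open>k - 1\<close> levels.\<close>

lemma bij_betw_later:
  "bij_betw (\<lambda>a. card (later a)) (nbrs - {1, N - 1}) {1..opens N T 0 - 1}"
proof -
  let ?A = "nbrs - {1, N - 1}"
  have fin: "finite (later a)" for a using finite_fan by (simp add: later_def)
  have less: "card (later b) < card (later a)" if a: "a \<in> nbrs - {N - 1}" and b: "a < b" for a b
  proof (rule psubset_card_mono[OF fin])
    obtain Q where "Q \<in> fan" "sec Q = a"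
      by (rule fan_obtain_sec[OF a])
    then have "Q \<in> later a" "Q \<notin> later b" using b by (auto simp: later_def)
    moreover have "later b \<subseteq> later a" using b by (auto simp: later_def)
    ultimately show "later b \<subset> later a" by blast
  qed
  have inj: "inj_on (\<lambda>a. card (later a)) ?A"
  proof (rule inj_onI, rule ccontr)
    fix a b assume "a \<in> ?A" "b \<in> ?A" "card (later a) = card (later b)" "a \<noteq> b"
    then show False using less[of a b] less[of b a] by (cases "a < b") auto
  qed
  have "card (later a) \<in> {1..opens N T 0 - 1}" if a: "a \<in> ?A" for a
  proof -
    have "1 < a" using a by (auto simp: nbrs_def)
    have "card (later (Suc a)) < card (later a)" using less[of a "Suc a"] a by simp
    moreover have "card (later a) < card (later 1)"
      using less[of 1 a] \<open>1 < a\<close> nbrs_ends N by simp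
    moreover have "card (later 1) \<le> opens N T 0"
      unfolding opens_0 using later_subset finite_fan by (intro card_mono) auto
    ultimately show ?thesis by simp
  qed
  then have sub: "(\<lambda>a. card (later a)) ` ?A \<subseteq> {1..opens N T 0 - 1}" by blast
  have "card ?A = card (nbrs - {N - 1} - {1})" by (rule arg_cong[where f = card]) auto
  also have "\<dots> = opens N T 0 - 1"
    using bij_betw_same_card[OF bij_betw_fan_sec] nbrs_ends N finite_nbrs
    by (subst card_Diff_singleton) (auto simp: opens_0)
  finally have "card ((\<lambda>a. card (later a)) ` ?A) = card {1..opens N T 0 - 1}"
    using card_image[OF inj] by simp
  then have "(\<lambda>a. card (later a)) ` ?A = {1..opens N T 0 - 1}"
    using sub by (intro card_subset_eq) auto
  then show ?thesis using inj by (simp add: bij_betw_def)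
qed

lemma passes_nbr: "a \<in> nbrs - {N - 1} \<Longrightarrow> 1 \<le> passes N T a"
proof -
  assume "a \<in> nbrs - {N - 1}"
  then obtain Q where Q: "Q \<in> fan" "sec Q = a"
    by (rule fan_obtain_sec)
  then have "Q \<in> {Q \<in> subgons N T. a \<in> Q \<and> Min Q < a \<and> a < Max Q}"
    using fan_sec[OF Q(1)] fan_Min[OF Q(1)] by (auto simp: fan_def)
  then have "{Q \<in> subgons N T. a \<in> Q \<and> Min Q < a \<and> a < Max Q} \<noteq> {}" by blast
  then show ?thesis
    unfolding passes_def using subgons_finite by (simp add: Suc_le_eq card_gt_0_iff)
qed

lemma brow_sigma: "brow N m (sigma N T) = rot_tilde m (brow N m T)"
proof -
  let ?r = "passes N T" and ?u = "opens N T" and ?A = "nbrs - {1, N - 1}"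
  \<comment> \<open>The last vertex contributes the empty block, so the word ends with block
    \<open>N - 2\<close>, matching the range in \<open>brow_sigma_eq\<close>.\<close>
  have "Suc (N - 1) = N" using N by simp
  then have "brow N m T = blocks ?r ?u (Suc (N - 1))"
    unfolding brow_eq blocks_def block_def[abs_def] by simp
  also have "\<dots> = blocks ?r ?u (N - 1)"
    unfolding blocks_Suc block_def passes_last opens_last by simp
  finally have brow: "brow N m T = blocks ?r ?u (N - 1)" .
  have "?A \<subseteq> {2..<N - 1}" by (auto simp: nbrs_def)
  then have "rot_tilde m (brow N m T) = U # replicate (?u 1) U @
    concat (map (\<lambda>i. replicate (?r i) R @ replicate ((if i \<in> ?A then 1 else 0) + ?u i) U) [2..<N - 1]) @ [R]"
    unfolding brow using passes_0 passes_1 passes_nbr height_ge_later height_at_nbr N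
    by (intro rot_tilde_blocks[where c = "\<lambda>a. card (later a)"] bij_betw_later) auto
  \<comment> \<open>The neighbours 1 and \<open>N - 1\<close> lie outside the range, so removing
    them from \<open>nbrs\<close> changes nothing.\<close>
  moreover have "map (\<lambda>i. replicate (?r i) R @ replicate ((if i \<in> ?A then 1 else 0) + ?u i) U) [2..<N - 1] =
    map (\<lambda>i. replicate (?r i) R @ replicate ((if i \<in> nbrs then 1 else 0) + ?u i) U) [2..<N - 1]"
    by (rule map_cong) auto
  ultimately show ?thesis unfolding brow_sigma_eq by (simp only:)
qed

end

theorem theorem5p12:
  fixes m l N :: nat and T :: "nat set set"
  assumes "1 \<le> m" and "1 \<le> l" and "N = m * l + 2"
    and "is_angulation N m T"
  shows "brow N m (sigma N T) = rot_tilde m (brow N m T)"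
proof -
  have "1 \<le> m * l" using assms by simp
  then have "3 \<le> N" using assms(3) by simp
  then interpret angulation N m T using assms(4) by unfold_locales
  show ?thesis by (rule brow_sigma)
qed

end
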